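(* Let $K$ be an abstract simplicial complex on the finite nonempty vertex set $V$, $|V|=n$, and let $K^{*}$ be its Alexander dual. Let $G$ be a finite group of automorphisms of the face poset of $K$, regarded as a subgroup of the group $\mathfrak{S}_n$ of permutations of $V$. Then for every integer $i$ there is an isomorphism of $\mathbb{C}[G]$-modules $$\widetilde{H}_{i}(K,\mathbb{C})\;\simeq_{G}\;\widetilde{H}^{n-i-3}(K^{*},\mathbb{C})\otimes \mathrm{sgn}.$$
   Context: The Alexander dual of $K$ is $K^{*}=\{\sigma\subseteq V : V\smallsetminus\sigma\notin K\}$, a simplicial complex on the same vertex set. $G$ consists of permutations $g$ of $V$ with $g(\sigma)\in K$ for all $\sigma\in K$; then $G$ also preserves $K^*$. $G$ acts on oriented chains by $g[j_1,\dots,j_{i+1}]=[g(j_1),\dots,g(j_{i+1})]$, and hence on reduced homology; it acts on cochains by the corresponding dual (left) action, $g\cdot[j_1,\dots,j_{i+1}]^{*}=[g(j_1),\dots,g(j_{i+1})]^{*}$, and hence on reduced cohomology. Reduced (co)homology is computed with the augmented complex, in which the empty face sits in degree $-1$. $\mathrm{sgn}$ is the restriction to $G$ of the sign representation of $\mathfrak{S}_n$. *)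

theory Defs
  imports
    "HOL-Algebra.Group"
    "HOL-Algebra.AbelCoset"
    "HOL-Algebra.Module"
    "HOL-Combinatorics.Permutations"
    "HOL-Library.Poly_Mapping"
    Complex_Main
begin

section \<open>Complexes, Alexander dual, permutation groups\<close>

text \<open>Neither \<^term>\<open>{} \<in> K\<close> nor \<^term>\<open>{v} \<in> K\<close> for \<^term>\<open>v \<in> V\<close> is required: Alexander duality
  exchanges the full simplex with the void complex, and the dual of a complex that has all its
  vertices need not have all of them.\<close>

definition simplicial_complex :: "'a set \<Rightarrow> 'a set set \<Rightarrow> bool" where
  "simplicial_complex V K \<longleftrightarrow> K \<subseteq> Pow V \<and> (\<forall>\<sigma>\<in>K. \<forall>\<tau>. \<tau> \<subseteq> \<sigma> \<longrightarrow> \<tau> \<in> K)"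

definition alexander_dual :: "'a set \<Rightarrow> 'a set set \<Rightarrow> 'a set set" where
  "alexander_dual V K = {\<sigma>. \<sigma> \<subseteq> V \<and> V - \<sigma> \<notin> K}"

definition symmetric_group :: "'a set \<Rightarrow> ('a \<Rightarrow> 'a) monoid" where
  "symmetric_group V = \<lparr>carrier = {p. p permutes V}, monoid.mult = (\<circ>), one = id\<rparr>"

section \<open>Modules over a complex group algebra\<close>

definition complex_ring :: "complex ring" where
  "complex_ring = \<lparr>carrier = UNIV, monoid.mult = (*), one = 1, zero = 0, add = (+)\<rparr>"

text \<open>A module over the group algebra of \<open>G\<close> is a complex vector space with a linear action of
  \<open>G\<close>. The record inherits the fields \<^const>\<open>monoid.mult\<close> and \<^const>\<open>monoid.one\<close> from the record of modules,
  where they play no role; they are left undefined below.\<close>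

record ('g, 'm) gmodule = "(complex, 'm) module" +
  act :: "'g \<Rightarrow> 'm \<Rightarrow> 'm"

locale cg_module = G?: group G + M?: Module.module complex_ring M
  for G :: "('g, 'x) monoid_scheme" (structure) and M :: "('g, 'm) gmodule" +
  assumes act_closed: "\<lbrakk>g \<in> carrier G; x \<in> carrier M\<rbrakk> \<Longrightarrow> act M g x \<in> carrier M"
    and act_add: "\<lbrakk>g \<in> carrier G; x \<in> carrier M; y \<in> carrier M\<rbrakk> \<Longrightarrow>
      act M g (x \<oplus>\<^bsub>M\<^esub> y) = act M g x \<oplus>\<^bsub>M\<^esub> act M g y"
    and act_smult: "\<lbrakk>g \<in> carrier G; x \<in> carrier M\<rbrakk> \<Longrightarrow>
      act M g (a \<odot>\<^bsub>M\<^esub> x) = a \<odot>\<^bsub>M\<^esub> act M g x"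
    and act_one: "x \<in> carrier M \<Longrightarrow> act M \<one>\<^bsub>G\<^esub> x = x"
    and act_mult: "\<lbrakk>g \<in> carrier G; h \<in> carrier G; x \<in> carrier M\<rbrakk> \<Longrightarrow>
      act M (g \<otimes>\<^bsub>G\<^esub> h) x = act M g (act M h x)"

definition cg_isomorphism ::
    "('g, 'x) monoid_scheme \<Rightarrow> ('g, 'm) gmodule \<Rightarrow> ('g, 'n) gmodule \<Rightarrow> ('m \<Rightarrow> 'n) \<Rightarrow> bool" where
  "cg_isomorphism G M N f \<longleftrightarrow>
     bij_betw f (carrier M) (carrier N) \<and>
     (\<forall>x\<in>carrier M. \<forall>y\<in>carrier M. f (x \<oplus>\<^bsub>M\<^esub> y) = f x \<oplus>\<^bsub>N\<^esub> f y) \<and>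
     (\<forall>a. \<forall>x\<in>carrier M. f (a \<odot>\<^bsub>M\<^esub> x) = a \<odot>\<^bsub>N\<^esub> f x) \<and>
     (\<forall>g\<in>carrier G. \<forall>x\<in>carrier M. f (act M g x) = act N g (f x))"

definition cg_isomorphic ::
    "('g, 'x) monoid_scheme \<Rightarrow> ('g, 'm) gmodule \<Rightarrow> ('g, 'n) gmodule \<Rightarrow> bool" where
  "cg_isomorphic G M N \<longleftrightarrow> cg_module G M \<and> cg_module G N \<and> (\<exists>f. cg_isomorphism G M N f)"

text \<open>The quotient by a subspace \<open>N\<close> that is stable under the action. The cosets of the results
  are formed over all representatives, which makes the choice of one unnecessary.\<close>

definition quotient_gmodule :: "('g, 'm) gmodule \<Rightarrow> 'm set \<Rightarrow> ('g, 'm set) gmodule" where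
  "quotient_gmodule M N =
     \<lparr>carrier = a_rcosets\<^bsub>M\<^esub> N, monoid.mult = undefined, one = undefined,
      zero = N, add = set_add M,
      smult = (\<lambda>a X. \<Union>x\<in>X. N +>\<^bsub>M\<^esub> (a \<odot>\<^bsub>M\<^esub> x)),
      act = (\<lambda>g X. \<Union>x\<in>X. N +>\<^bsub>M\<^esub> act M g x)\<rparr>"

text \<open>The tensor product over the complex numbers, with the diagonal action: the vector space
  with basis \<open>carrier M \<times> carrier N\<close> modulo the bilinearity relations.\<close>

definition free_gmodule_times ::
    "('g, 'm) gmodule \<Rightarrow> ('g, 'n) gmodule \<Rightarrow> ('g, ('m \<times> 'n) \<Rightarrow>\<^sub>0 complex) gmodule" where
  "free_gmodule_times M N =
     \<lparr>carrier = {u. Poly_Mapping.keys u \<subseteq> carrier M \<times> carrier N},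
      monoid.mult = undefined, one = undefined, zero = 0, add = (+),
      smult = (\<lambda>a. Poly_Mapping.map ((*) a)),
      act = (\<lambda>g u. \<Sum>(x, y)\<in>Poly_Mapping.keys u.
               Poly_Mapping.single (act M g x, act N g y) (Poly_Mapping.lookup u (x, y)))\<rparr>"

abbreviation pair_generator :: "'m \<Rightarrow> 'n \<Rightarrow> ('m \<times> 'n) \<Rightarrow>\<^sub>0 complex" where
  "pair_generator x y \<equiv> Poly_Mapping.single (x, y) 1"

definition bilinear_relations ::
    "('g, 'm) gmodule \<Rightarrow> ('g, 'n) gmodule \<Rightarrow> (('m \<times> 'n) \<Rightarrow>\<^sub>0 complex) set" where
  "bilinear_relations M N =
     {pair_generator (x \<oplus>\<^bsub>M\<^esub> x') y - pair_generator x y - pair_generator x' y | x x' y.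
        x \<in> carrier M \<and> x' \<in> carrier M \<and> y \<in> carrier N} \<union>
     {pair_generator x (y \<oplus>\<^bsub>N\<^esub> y') - pair_generator x y - pair_generator x y' | x y y'.
        x \<in> carrier M \<and> y \<in> carrier N \<and> y' \<in> carrier N} \<union>
     {pair_generator (a \<odot>\<^bsub>M\<^esub> x) y - Poly_Mapping.single (x, y) a | a x y.
        x \<in> carrier M \<and> y \<in> carrier N} \<union>
     {pair_generator x (a \<odot>\<^bsub>N\<^esub> y) - Poly_Mapping.single (x, y) a | a x y.
        x \<in> carrier M \<and> y \<in> carrier N}"

definition tensor_gmodule ::
    "('g, 'm) gmodule \<Rightarrow> ('g, 'n) gmodule \<Rightarrow> ('g, (('m \<times> 'n) \<Rightarrow>\<^sub>0 complex) set) gmodule" where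
  "tensor_gmodule M N =
     (let F = free_gmodule_times M N in
      quotient_gmodule F (\<Inter>{U. submodule U complex_ring F \<and> bilinear_relations M N \<subseteq> U}))"

definition sgn_gmodule :: "('a \<Rightarrow> 'a, complex) gmodule" where
  "sgn_gmodule =
     \<lparr>carrier = UNIV, monoid.mult = undefined, one = undefined, zero = 0, add = (+),
      smult = (*), act = (\<lambda>g z. of_int (sign g) * z)\<rparr>"

section \<open>Oriented chains and cochains\<close>

text \<open>An \<open>i\<close>-chain is a function on the ordered \<open>i\<close>-simplices \<open>[x\<^sub>0, \<dots>, x\<^sub>i]\<close> of \<open>K\<close> (lists of
  \<open>i + 1\<close> distinct vertices) that changes by the sign of the permutation when the vertices are
  permuted. It is extended by \<open>0\<close> to all other lists. In degree \<open>-1\<close> the only ordered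
  simplex is the empty list, provided that \<^term>\<open>{} \<in> K\<close>.

  The cochains are the same functions: the cochain \<open>\<phi>\<close> is the linear form on chains whose value
  on the oriented simplex \<open>[x\<^sub>0, \<dots>, x\<^sub>i]\<close> is \<open>\<phi> [x\<^sub>0, \<dots>, x\<^sub>i]\<close>.\<close>

definition oriented_chains :: "'a set set \<Rightarrow> int \<Rightarrow> ('a list \<Rightarrow> complex) set" where
  "oriented_chains K i =
     {c. (\<forall>xs. c xs \<noteq> 0 \<longrightarrow> distinct xs \<and> set xs \<in> K \<and> int (length xs) = i + 1) \<and>
         (\<forall>xs p. p permutes {..<length xs} \<longrightarrow> c (permute_list p xs) = of_int (sign p) * c xs)}"

text \<open>The oriented simplex \<open>[x\<^sub>0, \<dots>, x\<^sub>i]\<close> as a chain, for distinct vertices. As a cochain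
  this is the dual basis element \<open>[x\<^sub>0, \<dots>, x\<^sub>i]\<^sup>*\<close>.\<close>

definition oriented_simplex :: "'a list \<Rightarrow> 'a list \<Rightarrow> complex" where
  "oriented_simplex xs ys =
     (\<Sum>p | p permutes {..<length xs} \<and> permute_list p xs = ys. of_int (sign p))"

text \<open>The common action on chains and cochains: \<open>g\<close> maps \<open>[x\<^sub>0, \<dots>, x\<^sub>i]\<close> to
  \<open>[g x\<^sub>0, \<dots>, g x\<^sub>i]\<close>, see \<open>chain_act_oriented_simplex\<close> below.\<close>

definition chain_act :: "('a \<Rightarrow> 'a) \<Rightarrow> ('a list \<Rightarrow> complex) \<Rightarrow> 'a list \<Rightarrow> complex" where
  "chain_act g c = (\<lambda>xs. c (map (inv_into UNIV g) xs))"

definition chain_gmodule ::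
    "('a list \<Rightarrow> complex) set \<Rightarrow> ('a \<Rightarrow> 'a, 'a list \<Rightarrow> complex) gmodule" where
  "chain_gmodule C =
     \<lparr>carrier = C, monoid.mult = undefined, one = undefined,
      zero = (\<lambda>xs. 0), add = (\<lambda>c d xs. c xs + d xs),
      smult = (\<lambda>a c xs. a * c xs), act = chain_act\<rparr>"

definition delete_nth :: "nat \<Rightarrow> 'a list \<Rightarrow> 'a list" where
  "delete_nth j xs = take j xs @ drop (Suc j) xs"

text \<open>This is the usual boundary
  \<open>\<partial>[x\<^sub>0, \<dots>, x\<^sub>i] = \<Sum>\<^sub>j (-1)^j [x\<^sub>0, \<dots>, x\<^sub>j\<^sub>-\<^sub>1, x\<^sub>j\<^sub>+\<^sub>1, \<dots>, x\<^sub>i]\<close>, written in terms of the coefficients of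
  the chain; see \<open>boundary_oriented_simplex\<close> below. On degree \<open>0\<close> it is the augmentation.\<close>

definition boundary :: "'a set \<Rightarrow> ('a list \<Rightarrow> complex) \<Rightarrow> 'a list \<Rightarrow> complex" where
  "boundary V c = (\<lambda>ys. \<Sum>v\<in>V. c (v # ys))"

text \<open>The transpose of the boundary: \<open>(\<delta>\<phi>)[x\<^sub>0, \<dots>, x\<^sub>i] = \<phi>(\<partial>[x\<^sub>0, \<dots>, x\<^sub>i])\<close> on the simplices of
  \<open>K\<close>.\<close>

definition coboundary :: "'a set set \<Rightarrow> ('a list \<Rightarrow> complex) \<Rightarrow> 'a list \<Rightarrow> complex" where
  "coboundary K \<phi> = (\<lambda>xs. if distinct xs \<and> set xs \<in> K
     then \<Sum>j<length xs. (-1) ^ j * \<phi> (delete_nth j xs) else 0)"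

definition reduced_homology ::
    "'a set \<Rightarrow> 'a set set \<Rightarrow> int \<Rightarrow> ('a \<Rightarrow> 'a, ('a list \<Rightarrow> complex) set) gmodule" where
  "reduced_homology V K i =
     quotient_gmodule
       (chain_gmodule {c \<in> oriented_chains K i. boundary V c = (\<lambda>xs. 0)})
       (boundary V ` oriented_chains K (i + 1))"

definition reduced_cohomology ::
    "'a set set \<Rightarrow> int \<Rightarrow> ('a \<Rightarrow> 'a, ('a list \<Rightarrow> complex) set) gmodule" where
  "reduced_cohomology K i =
     quotient_gmodule
       (chain_gmodule {\<phi> \<in> oriented_chains K i. coboundary K \<phi> = (\<lambda>xs. 0)})
       (coboundary K ` oriented_chains K (i - 1))"

section \<open>Values on oriented simplices\<close>

lemma permute_list_eqD:
  assumes "distinct xs" "p permutes {..<length xs}" "q permutes {..<length xs}"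
    "permute_list p xs = permute_list q xs"
  shows "p = q"
proof
  fix i
  show "p i = q i"
  proof (cases "i < length xs")
    case True
    then have "xs ! p i = xs ! q i"
      using assms by (metis permute_list_nth)
    moreover have "p i < length xs" "q i < length xs"
      using True assms(2,3) by (metis lessThan_iff permutes_in_image)+
    ultimately show ?thesis
      using assms(1) by (simp add: nth_eq_iff_index_eq)
  next
    case False
    then show ?thesis
      using assms(2,3) by (simp add: permutes_not_in)
  qed
qed

lemma oriented_simplex_permute:
  assumes "distinct xs" "p permutes {..<length xs}"
  shows "oriented_simplex xs (permute_list p xs) = of_int (sign p)"
proof -
  have "{q. q permutes {..<length xs} \<and> permute_list q xs = permute_list p xs} = {p}"
    using assms permute_list_eqD by blast
  then show ?thesis
    by (simp add: oriented_simplex_def)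
qed

lemma oriented_simplex_eq_0:
  assumes "mset ys \<noteq> mset xs"
  shows "oriented_simplex xs ys = 0"
proof -
  have "{p. p permutes {..<length xs} \<and> permute_list p xs = ys} = {}"
    using assms by auto
  then show ?thesis
    by (simp only: oriented_simplex_def sum.empty)
qed

lemma oriented_simplex_permute_left:
  assumes "distinct xs" "q permutes {..<length xs}"
  shows "oriented_simplex (permute_list q xs) ys = of_int (sign q) * oriented_simplex xs ys"
proof (cases "mset ys = mset xs")
  case False
  then show ?thesis
    using assms by (simp add: oriented_simplex_eq_0)
next
  case True
  then obtain r where r: "r permutes {..<length xs}" "permute_list r xs = ys"
    using mset_eq_permutation by blast
  define p where "p = inv_into UNIV q \<circ> r"
  have p: "p permutes {..<length xs}"
    unfolding p_def using assms(2) r(1) by (simp add: permutes_compose permutes_inv)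
  have "q \<circ> p = r"
    unfolding p_def using permutes_inv_o(1)[OF assms(2)] by (simp add: o_assoc)
  then have ys: "permute_list p (permute_list q xs) = ys"
    using permute_list_compose[OF p, of q] r(2) by simp
  have perms: "permutation q" "permutation r"
    using assms(2) r(1) by (meson finite_lessThan permutation_permutes)+
  have "sign p = sign q * sign r"
    unfolding p_def using perms by (simp add: sign_compose sign_inverse permutation_inverse)
  moreover have "oriented_simplex (permute_list q xs) ys = of_int (sign p)"
    using oriented_simplex_permute[of "permute_list q xs" p] assms p ys by simp
  moreover have "oriented_simplex xs ys = of_int (sign r)"
    using oriented_simplex_permute[OF assms(1) r(1)] r(2) by simp
  ultimately show ?thesis
    by simp
qed

lemma oriented_simplex_in_chains:
  assumes "distinct xs" "set xs \<in> K"
  shows "oriented_simplex xs \<in> oriented_chains K (int (length xs) - 1)"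
proof -
  have *: "distinct ys \<and> set ys \<in> K \<and> int (length ys) = int (length xs) - 1 + 1"
    if "oriented_simplex xs ys \<noteq> 0" for ys
  proof -
    have "mset ys = mset xs"
      using that oriented_simplex_eq_0 by blast
    then show ?thesis
      using assms by (metis diff_add_cancel mset_eq_imp_distinct_iff mset_eq_length mset_eq_setD)
  qed
  have "oriented_simplex xs (permute_list p ys) = of_int (sign p) * oriented_simplex xs ys"
    if p: "p permutes {..<length ys}" for p ys
  proof (cases "mset ys = mset xs")
    case False
    then show ?thesis
      using p by (simp add: oriented_simplex_eq_0)
  next
    case True
    then obtain r where r: "r permutes {..<length xs}" "permute_list r xs = ys"
      using mset_eq_permutation by blast
    have len: "length ys = length xs"
      using True by (rule mset_eq_length)
    have "permute_list p ys = permute_list (r \<circ> p) xs"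
      using permute_list_compose[of p xs r] p r(2) len by simp
    moreover have "r \<circ> p permutes {..<length xs}"
      using p r(1) len by (simp add: permutes_compose)
    moreover have "sign (r \<circ> p) = sign r * sign p"
      using p r(1) by (meson finite_lessThan permutation_permutes sign_compose)
    ultimately show ?thesis
      using oriented_simplex_permute[OF assms(1)] r by (metis mult.commute of_int_mult)
  qed
  with * show ?thesis
    by (simp add: oriented_chains_def)
qed

lemma chain_act_oriented_simplex:
  assumes "bij g"
  shows "chain_act g (oriented_simplex xs) = oriented_simplex (map g xs)"
proof
  fix ys
  have "permute_list p xs = map (inv_into UNIV g) ys \<longleftrightarrow> permute_list p (map g xs) = ys"
    if "p permutes {..<length xs}" for p
  proof -
    have "permute_list p (map g xs) = map g (permute_list p xs)"
      using that by (simp add: permute_list_map)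
    moreover have "map g (map (inv_into UNIV g) ys) = ys" "map (inv_into UNIV g) (map g zs) = zs" for zs
      using assms by (simp_all add: bij_is_surj bij_is_inj surj_f_inv_f map_idI)
    ultimately show ?thesis
      by metis
  qed
  then show "chain_act g (oriented_simplex xs) ys = oriented_simplex (map g xs) ys"
    unfolding chain_act_def oriented_simplex_def by (auto intro!: sum.cong)
qed

lemma oriented_simplex_Cons:
  assumes "distinct (v # zs)"
  shows "oriented_simplex (v # zs) (v # ys) = oriented_simplex zs ys"
proof (cases "mset ys = mset zs")
  case False
  then show ?thesis
    by (simp add: oriented_simplex_eq_0)
next
  case True
  then obtain p where p: "p permutes {..<length zs}" "permute_list p zs = ys"
    using mset_eq_permutation by blast
  define q where "q = map_permutation {..<length zs} Suc p"
  have bij: "bij_betw Suc {..<length zs} {1..length zs}"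
    by (simp add: bij_betw_def image_Suc_lessThan)
  have q: "q permutes {1..length zs}"
    unfolding q_def using map_permutation_permutes[OF bij p(1)] .
  have q': "q permutes {..<length (v # zs)}"
    using q by (rule permutes_subset) auto
  have "sign q = sign p"
    unfolding q_def using p(1) by (intro sign_map_permutation) auto
  moreover have "permute_list q (v # zs) = v # ys"
  proof (rule nth_equalityI)
    show "length (permute_list q (v # zs)) = length (v # ys)"
      using p(2) by auto
    fix i assume "i < length (permute_list q (v # zs))"
    then have i: "i < length (v # zs)"
      by simp
    show "permute_list q (v # zs) ! i = (v # ys) ! i"
    proof (cases i)
      case 0
      then show ?thesis
        using permute_list_nth[OF q' i] permutes_not_in[OF q, of 0] by simp
    next
      case (Suc k)
      then have k: "k < length zs"
        using i by simp
      have "q (Suc k) = Suc (p k)"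
        unfolding q_def map_permutation_def restrict_id_def using k by simp
      then show ?thesis
        using permute_list_nth[OF q' i] permute_list_nth[OF p(1) k] p(2) Suc by simp
    qed
  qed
  ultimately show ?thesis
    using oriented_simplex_permute[OF assms q'] oriented_simplex_permute[of zs p] p assms by simp
qed

lemma oriented_simplex_swap:
  assumes "distinct (as @ u # v # bs)"
  shows "oriented_simplex (as @ v # u # bs) ys = - oriented_simplex (as @ u # v # bs) ys"
proof -
  let ?xs = "as @ u # v # bs" and ?t = "transpose (length as) (Suc (length as))"
  have t: "?t permutes {..<length ?xs}"
    by (rule permutes_swap_id) auto
  have "permute_list ?t ?xs = as @ v # u # bs"
  proof (rule nth_equalityI)
    fix i assume "i < length (permute_list ?t ?xs)"
    then have "permute_list ?t ?xs ! i = ?xs ! ?t i"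
      using permute_list_nth[OF t] by simp
    also have "\<dots> = (as @ v # u # bs) ! i"
      by (auto simp: transpose_def nth_append nth_Cons split: nat.splits)
    finally show "permute_list ?t ?xs ! i = (as @ v # u # bs) ! i" .
  qed simp
  then show ?thesis
    using oriented_simplex_permute_left[OF assms t, of ys] by (simp add: sign_swap_id)
qed

lemma oriented_simplex_move:
  assumes "distinct (as @ v # bs)"
  shows "oriented_simplex (as @ v # bs) ys = (-1) ^ length as * oriented_simplex (v # as @ bs) ys"
  using assms
proof (induction as arbitrary: bs rule: rev_induct)
  case (snoc a as)
  then show ?case
    using oriented_simplex_swap[of as v a bs ys] snoc.IH[of "a # bs"] by auto
qed simp

lemma boundary_oriented_simplex:
  assumes "finite V" "distinct xs" "set xs \<subseteq> V"
  shows "boundary V (oriented_simplex xs) =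
    (\<lambda>ys. \<Sum>j<length xs. (-1) ^ j * oriented_simplex (delete_nth j xs) ys)"
proof
  fix ys
  have "(\<Sum>v\<in>V. oriented_simplex xs (v # ys)) = (\<Sum>v\<in>set xs. oriented_simplex xs (v # ys))"
  proof (rule sum.mono_neutral_right[OF assms(1,3)], rule ballI)
    fix v assume "v \<in> V - set xs"
    then have "mset (v # ys) \<noteq> mset xs"
      by (metis DiffD2 list.set_intros(1) mset_eq_setD)
    then show "oriented_simplex xs (v # ys) = 0"
      by (rule oriented_simplex_eq_0)
  qed
  also have "\<dots> = (\<Sum>j<length xs. oriented_simplex xs (xs ! j # ys))"
    using sum.reindex_bij_betw[OF bij_betw_nth[OF assms(2) refl refl],
        of "\<lambda>v. oriented_simplex xs (v # ys)"] by simp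
  also have "\<dots> = (\<Sum>j<length xs. (-1) ^ j * oriented_simplex (delete_nth j xs) ys)"
  proof (rule sum.cong[OF refl])
    fix j assume "j \<in> {..<length xs}"
    then have j: "j < length xs"
      by simp
    have split: "xs = take j xs @ xs ! j # drop (Suc j) xs"
      using j by (rule id_take_nth_drop)
    have "distinct (xs ! j # delete_nth j xs)"
    proof -
      have "distinct (take j xs @ xs ! j # drop (Suc j) xs)"
        using split assms(2) by metis
      then show ?thesis
        unfolding delete_nth_def by auto
    qed
    then show "oriented_simplex xs (xs ! j # ys) = (-1) ^ j * oriented_simplex (delete_nth j xs) ys"
      using oriented_simplex_move[of "take j xs" "xs ! j" "drop (Suc j) xs" "xs ! j # ys"]
        split assms(2) j oriented_simplex_Cons
      by (metis delete_nth_def length_take min.absorb4)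
  qed
  finally show "boundary V (oriented_simplex xs) ys =
      (\<Sum>j<length xs. (-1) ^ j * oriented_simplex (delete_nth j xs) ys)"
    by (simp add: boundary_def)
qed

end

theory Submission
  imports Defs
begin

text \<open>The duality is realised by one explicit map of chains. Let \<open>\<Delta>\<close> be the full simplex on \<open>V\<close>, and
  let \<open>\<partial>\<close> and \<open>\<delta>\<close> be the boundary and the coboundary of \<open>\<Delta>\<close>, which act on the same space of alternating
  functions. Two facts about \<open>\<Delta>\<close> carry the proof.

  First, an orientation \<open>\<omega>\<close> of \<open>V\<close> (an alternating function with values \<open>\<plusminus>1\<close> on the enumerations of \<open>V\<close>)
  gives a star operator, which transports the value of a chain on a simplex to the complementary
  simplex. It is bijective, it satisfies \<open>star \<circ> \<partial> = \<delta> \<circ> star\<close> (\<open>star_boundary\<close>), and it commutes with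
  a permutation \<open>g\<close> of \<open>V\<close> up to the factor \<open>sign g\<close> (\<open>star_chain_act\<close>), because \<open>g\<close> multiplies \<open>\<omega>\<close> by
  \<open>sign g\<close>. This is where the sign representation comes from. A chain is supported on \<open>K\<close> exactly
  if its star vanishes on the Alexander dual \<open>K\<^sup>*\<close> (\<open>restrict_star_eq_0_iff\<close>). Hence star identifies the
  relative chains of \<open>(\<Delta>, K)\<close> with the cochains of \<open>K\<^sup>*\<close>.

  Second, \<open>\<partial>\<delta> + \<delta>\<partial> = n\<close> on \<open>\<Delta>\<close> (\<open>laplacian_full_simplex\<close>). Since \<open>n\<close> is invertible in the complex
  numbers, \<open>\<delta>/n\<close> is a contracting homotopy of \<open>\<Delta>\<close>, and it commutes with all permutations. It inverts
  the connecting map \<open>H\<^sub>i\<^sub>+\<^sub>1(\<Delta>, K) \<rightarrow> H\<^sub>i(K)\<close> on the level of chains.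

  So the map \<open>c \<mapsto> star (\<delta> c)\<close>, restricted to the simplices of \<open>K\<^sup>*\<close>, takes the \<open>i\<close>-cycles of \<open>K\<close> to the
  \<open>(n-i-3)\<close>-cocycles of \<open>K\<^sup>*\<close> and is equivariant up to the sign of the permutation. The two facts show
  that a cycle goes to a coboundary exactly if it is a boundary (\<open>duality_map_coboundary_iff\<close>), and
  that every cocycle is reached modulo coboundaries (\<open>duality_map_onto\<close>). The induced map is
  therefore an isomorphism from homology to cohomology with the action multiplied by the sign. For
  every module, the module with the action so multiplied is isomorphic to the tensor product with
  the sign representation (\<open>tensor_sgn_isomorphism\<close>).\<close>

section \<open>Alternating functions on lists\<close>

text \<open>Antisymmetry is required only for exchanges of neighbours. This can be checked by recursion on the
  list, and it passes at once to the functions obtained by fixing a prefix or a suffix of the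
  argument. It agrees with the condition on all permutations of the positions by
  \<open>alternating_iff_permute_list\<close>.\<close>

definition alternating :: "('a list \<Rightarrow> complex) \<Rightarrow> bool" where
  "alternating c \<longleftrightarrow> (\<forall>as u v bs. c (as @ v # u # bs) = - c (as @ u # v # bs))"

lemma alternatingI:
  "(\<And>as u v bs. c (as @ v # u # bs) = - c (as @ u # v # bs)) \<Longrightarrow> alternating c"
  unfolding alternating_def by blast

lemma alternatingD: "alternating c \<Longrightarrow> c (as @ v # u # bs) = - c (as @ u # v # bs)"
  unfolding alternating_def by blast

lemma alternating_prefix:
  assumes "alternating c"
  shows "alternating (\<lambda>ys. c (zs @ ys))"
  unfolding alternating_def
proof (intro allI)
  fix as bs and u v :: 'a
  show "c (zs @ as @ v # u # bs) = - c (zs @ as @ u # v # bs)"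
    using alternatingD[OF assms, of "zs @ as" v u bs] by simp
qed

lemma alternating_Cons: "alternating c \<Longrightarrow> alternating (\<lambda>ys. c (v # ys))"
  using alternating_prefix[of c "[v]"] by simp

lemma alternating_rev_suffix:
  assumes "alternating c"
  shows "alternating (\<lambda>xs. c (rev xs @ ys))"
  unfolding alternating_def
proof (intro allI)
  fix as bs and u v :: 'a
  show "c (rev (as @ v # u # bs) @ ys) = - c (rev (as @ u # v # bs) @ ys)"
    using alternatingD[OF assms, of "rev bs" u v "rev as @ ys"] by simp
qed

lemma alternating_smult: "alternating c \<Longrightarrow> alternating (\<lambda>xs. a * c xs)"
  by (rule alternatingI, drule arg_cong[OF alternatingD, where f = "(*) a"]) simp

lemma alternating_move:
  assumes "alternating c"
  shows "c (as @ ms @ v # bs) = (-1) ^ length ms * c (as @ v # ms @ bs)"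
proof (induction ms arbitrary: bs rule: rev_induct)
  case (snoc m ms)
  then show ?case
    using alternatingD[OF assms, of "as @ ms" v m bs] by simp
qed simp

lemma alternating_not_distinct:
  assumes "alternating c" "\<not> distinct xs"
  shows "c xs = 0"
proof -
  obtain as ms bs v where xs: "xs = as @ [v] @ ms @ [v] @ bs"
    using not_distinct_decomp[OF assms(2)] by blast
  have "c (as @ v # v # ms @ bs) = 0"
    using alternatingD[OF assms(1), of as v v "ms @ bs"] by simp
  then show ?thesis
    using alternating_move[OF assms(1), of "as @ [v]" ms v bs] xs by simp
qed

text \<open>Both sides are moved to lists in which \<open>u\<close> and \<open>v\<close> are neighbours. The two moves pass the same
  \<open>ms\<close>, so their signs agree, and one exchange of neighbours remains.\<close>

lemma alternating_exchange:
  assumes "alternating c"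
  shows "c (as @ v # ms @ u # bs) = - c (as @ u # ms @ v # bs)"
  using alternating_move[OF assms, of "as @ [v]" ms u bs]
    alternating_move[OF assms, of "as @ [u]" ms v bs]
    alternatingD[OF assms, of as v u "ms @ bs"] by simp

lemma alternating_map_transpose:
  assumes "alternating c" "distinct zs" "a \<in> set zs" "b \<in> set zs" "a \<noteq> b"
  shows "c (map (transpose a b) zs) = - c zs"
proof -
  obtain as cs where zs: "zs = as @ a # cs"
    using split_list[OF assms(3)] by blast
  have fix_ab: "map (transpose a b) xs = xs" if "a \<notin> set xs" "b \<notin> set xs" for xs
    using that by (intro map_idI) (auto simp: transpose_def)
  from assms(4,5) zs consider "b \<in> set as" | "b \<in> set cs"
    by auto
  then show ?thesis
  proof cases
    case 1
    then obtain ds ms where as: "as = ds @ b # ms"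
      using split_list by metis
    then have "map (transpose a b) zs = ds @ a # ms @ b # cs"
      using assms(2,5) zs by (simp add: fix_ab)
    then show ?thesis
      using alternating_exchange[OF assms(1), of ds a ms b cs] zs as by simp
  next
    case 2
    then obtain ms bs where cs: "cs = ms @ b # bs"
      using split_list by metis
    then have "map (transpose a b) zs = as @ b # ms @ a # bs"
      using assms(2,5) zs by (simp add: fix_ab)
    then show ?thesis
      using alternating_exchange[OF assms(1), of as b ms a bs] zs cs by simp
  qed
qed

text \<open>For an enumeration of \<open>V\<close> this is the statement that a permutation of \<open>V\<close> multiplies an
  orientation by its sign. For the list \<open>[0, \<dots>, k - 1]\<close> it yields the effect of a permutation of
  positions, which is the next lemma.\<close>

lemma alternating_map_permutes:
  assumes "alternating c" "distinct zs" "p permutes set zs"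
  shows "c (map p zs) = of_int (sign p) * c zs"
  using assms(3) finite_set
proof (induction rule: permutes_induct)
  case (swap a b p)
  have "permutation p"
    using swap by (meson finite_set permutation_permutes)
  then have sgn: "sign (transpose a b \<circ> p) = - sign p"
    using swap by (simp add: sign_compose permutation_swap_id sign_swap_id)
  have "c (map (transpose a b) (map p zs)) = - c (map p zs)"
    using swap assms(1,2) permutes_image[OF \<open>p permutes set zs\<close>]
    by (intro alternating_map_transpose) (auto simp: distinct_map permutes_inj_on)
  then show ?case
    unfolding sgn swap.IH by (simp add: comp_def)
qed simp

lemma alternating_permute_list:
  assumes "alternating c" "p permutes {..<length xs}"
  shows "c (permute_list p xs) = of_int (sign p) * c xs"
proof -
  \<comment> \<open>A permutation of the positions of \<open>xs\<close> is a permutation of the entries of the list of positions.\<close>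
  have "alternating (\<lambda>js. c (map ((!) xs) js))"
    unfolding alternating_def
  proof (intro allI)
    fix as bs u v
    show "c (map ((!) xs) (as @ v # u # bs)) = - c (map ((!) xs) (as @ u # v # bs))"
      unfolding map_append list.map by (rule alternatingD[OF assms(1)])
  qed
  from alternating_map_permutes[OF this, of "[0..<length xs]" p] assms(2)
  show ?thesis
    by (simp add: permute_list_def map_nth lessThan_atLeast0 comp_def)
qed

lemma alternating_iff_permute_list:
  "alternating c \<longleftrightarrow>
    (\<forall>xs p. p permutes {..<length xs} \<longrightarrow> c (permute_list p xs) = of_int (sign p) * c xs)"
proof
  assume R: "\<forall>xs p. p permutes {..<length xs} \<longrightarrow> c (permute_list p xs) = of_int (sign p) * c xs"
  show "alternating c"
    unfolding alternating_def
  proof (intro allI)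
    fix as bs and u v :: 'a
    let ?xs = "as @ u # v # bs" and ?t = "transpose (length as) (Suc (length as))"
    have t: "?t permutes {..<length ?xs}"
      by (rule permutes_swap_id) auto
    have "permute_list ?t ?xs = as @ v # u # bs"
    proof (rule nth_equalityI)
      fix i assume "i < length (permute_list ?t ?xs)"
      then have "permute_list ?t ?xs ! i = ?xs ! ?t i"
        using permute_list_nth[OF t] by simp
      also have "\<dots> = (as @ v # u # bs) ! i"
        by (auto simp: transpose_def nth_append nth_Cons split: nat.splits)
      finally show "permute_list ?t ?xs ! i = (as @ v # u # bs) ! i" .
    qed simp
    then show "c (as @ v # u # bs) = - c ?xs"
      using R t by (metis mult_minus1 n_not_Suc_n of_int_1 of_int_minus sign_swap_id)
  qed
qed (simp add: alternating_permute_list)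

lemma alternating_rev:
  assumes "alternating c"
  shows "c (rev zs) = (-1) ^ (\<Sum>k<length zs. k) * c zs"
  using assms
proof (induction zs arbitrary: c)
  case (Cons z zs)
  have "c (rev (z # zs)) = (-1) ^ length zs * c (z # rev zs)"
    using alternating_move[OF Cons.prems, of "[]" "rev zs" z "[]"] by simp
  then show ?case
    using Cons.IH[OF alternating_Cons[OF Cons.prems, of z]] by (simp add: power_add)
qed simp

section \<open>Chains\<close>

text \<open>Alternating functions vanish on lists with a repetition, so these are exactly the chains of \<open>K\<close>,
  of mixed degrees. The degree is kept separate because the identities between the operators hold in
  all degrees at once.\<close>

definition alternating_chain :: "'a set set \<Rightarrow> ('a list \<Rightarrow> complex) \<Rightarrow> bool" where
  "alternating_chain K c \<longleftrightarrow> alternating c \<and> (\<forall>xs. c xs \<noteq> 0 \<longrightarrow> set xs \<in> K)"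

definition has_degree :: "int \<Rightarrow> ('a list \<Rightarrow> complex) \<Rightarrow> bool" where
  "has_degree i c \<longleftrightarrow> (\<forall>xs. c xs \<noteq> 0 \<longrightarrow> int (length xs) = i + 1)"

lemma oriented_chains_iff:
  "c \<in> oriented_chains K i \<longleftrightarrow> alternating_chain K c \<and> has_degree i c"
  unfolding oriented_chains_def alternating_chain_def has_degree_def
    alternating_iff_permute_list[symmetric]
  using alternating_not_distinct by auto

definition restrict_chain :: "'a set set \<Rightarrow> ('a list \<Rightarrow> complex) \<Rightarrow> 'a list \<Rightarrow> complex" where
  "restrict_chain K c = (\<lambda>xs. if set xs \<in> K then c xs else 0)"

lemma set_swap: "set (as @ v # u # bs) = set (as @ u # v # bs)"
  by auto

lemma alternating_restrict:
  assumes "alternating c"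
  shows "alternating (restrict_chain K c)"
proof (rule alternatingI)
  fix as u v bs
  show "restrict_chain K c (as @ v # u # bs) = - restrict_chain K c (as @ u # v # bs)"
    using alternatingD[OF assms, of as v u bs] unfolding restrict_chain_def set_swap[of as v u bs]
    by simp
qed

lemma alternating_chain_restrict: "alternating c \<Longrightarrow> alternating_chain K (restrict_chain K c)"
  unfolding alternating_chain_def using alternating_restrict[of c K] by (simp add: restrict_chain_def)

lemma has_degree_restrict: "has_degree i c \<Longrightarrow> has_degree i (restrict_chain K c)"
  by (auto simp: has_degree_def restrict_chain_def)

lemma alternating_chain_mono: "K \<subseteq> L \<Longrightarrow> alternating_chain K c \<Longrightarrow> alternating_chain L c"
  unfolding alternating_chain_def by blast

lemma restrict_chain_ident: "alternating_chain K c \<Longrightarrow> restrict_chain K c = c"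
  by (intro ext) (auto simp: alternating_chain_def restrict_chain_def)

text \<open>The coboundary without its restriction to the simplices of a complex. It satisfies a recursion
  on lists, which is the source of its properties.\<close>

definition deletion_sum :: "('a list \<Rightarrow> complex) \<Rightarrow> 'a list \<Rightarrow> complex" where
  "deletion_sum \<phi> xs = (\<Sum>j<length xs. (-1) ^ j * \<phi> (delete_nth j xs))"

lemma deletion_sum_Nil [simp]: "deletion_sum \<phi> [] = 0"
  by (simp add: deletion_sum_def)

lemma deletion_sum_Cons [simp]:
  "deletion_sum \<phi> (v # xs) = \<phi> xs - deletion_sum (\<lambda>ys. \<phi> (v # ys)) xs"
proof -
  have "deletion_sum \<phi> (v # xs) =
      \<phi> xs + (\<Sum>j<length xs. (-1) ^ Suc j * \<phi> (v # delete_nth j xs))"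
    unfolding deletion_sum_def
    by (simp only: length_Cons sum.lessThan_Suc_shift) (simp add: delete_nth_def)
  then show ?thesis
    by (simp add: deletion_sum_def sum_negf)
qed

lemma deletion_sum_minus: "deletion_sum (\<lambda>xs. - \<phi> xs) xs = - deletion_sum \<phi> xs"
  by (simp add: deletion_sum_def sum_negf)

lemma deletion_sum_diff:
  "deletion_sum (\<lambda>xs. \<phi> xs - \<psi> xs) xs = deletion_sum \<phi> xs - deletion_sum \<psi> xs"
  by (simp add: deletion_sum_def sum_subtractf algebra_simps)

lemma deletion_sum_sum:
  "deletion_sum (\<lambda>xs. \<Sum>v\<in>V. \<phi> v xs) xs = (\<Sum>v\<in>V. deletion_sum (\<phi> v) xs)"
  unfolding deletion_sum_def by (simp add: sum_distrib_left) (rule sum.swap)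

lemma deletion_sum_deletion_sum: "deletion_sum (deletion_sum \<phi>) xs = 0"
  by (induction xs arbitrary: \<phi>) (simp_all add: deletion_sum_diff)

lemma alternating_deletion_sum:
  assumes "alternating \<phi>"
  shows "alternating (deletion_sum \<phi>)"
proof -
  have "deletion_sum \<phi> (as @ v # u # bs) = - deletion_sum \<phi> (as @ u # v # bs)" for as u v bs
    using assms
  proof (induction as arbitrary: \<phi>)
    case Nil
    then have "\<phi> (v # u # ys) = - \<phi> (u # v # ys)" for ys
      using alternatingD[of \<phi> "[]" v u ys] by simp
    then show ?case
      by (simp add: deletion_sum_minus)
  next
    case (Cons a as)
    show ?case
      using alternatingD[OF Cons.prems, of as v u bs] Cons.IH[OF alternating_Cons[OF Cons.prems, of a]]
      by simp
  qed
  then show ?thesis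
    unfolding alternating_def by blast
qed

lemma set_delete_nth: "set (delete_nth j xs) \<subseteq> set xs"
  unfolding delete_nth_def by (auto dest: in_set_takeD in_set_dropD)

lemma coboundary_eq:
  assumes "alternating \<phi>"
  shows "coboundary K \<phi> = restrict_chain K (deletion_sum \<phi>)"
  using alternating_not_distinct[OF alternating_deletion_sum[OF assms]]
  by (auto simp: coboundary_def restrict_chain_def deletion_sum_def[abs_def])

lemma alternating_chain_coboundary: "alternating \<phi> \<Longrightarrow> alternating_chain K (coboundary K \<phi>)"
  by (simp add: coboundary_eq alternating_chain_restrict alternating_deletion_sum)

lemma has_degree_coboundary:
  assumes "has_degree i \<phi>"
  shows "has_degree (i + 1) (coboundary K \<phi>)"
proof -
  have "int (length xs) = i + 2" if "coboundary K \<phi> xs \<noteq> 0" for xs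
  proof -
    from that have "(\<Sum>j<length xs. (-1) ^ j * \<phi> (delete_nth j xs)) \<noteq> 0"
      unfolding coboundary_def by (auto split: if_splits)
    then obtain j where "j \<in> {..<length xs}" "(-1) ^ j * \<phi> (delete_nth j xs) \<noteq> 0"
      by (rule sum.not_neutral_contains_not_neutral)
    then have "int (length (delete_nth j xs)) = i + 1" and j: "j < length xs"
      using assms unfolding has_degree_def by auto
    moreover have "Suc (length (delete_nth j xs)) = length xs"
      using j by (simp add: delete_nth_def)
    ultimately show ?thesis
      by linarith
  qed
  then show ?thesis
    unfolding has_degree_def by auto
qed

lemma coboundary_restrict:
  assumes "\<forall>\<sigma>\<in>L. \<forall>\<tau>. \<tau> \<subseteq> \<sigma> \<longrightarrow> \<tau> \<in> L"
  shows "coboundary L (restrict_chain L \<phi>) = coboundary L \<phi>"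
proof
  fix xs
  have "set (delete_nth j xs) \<in> L" if "set xs \<in> L" for j
    using assms that set_delete_nth by metis
  then show "coboundary L (restrict_chain L \<phi>) xs = coboundary L \<phi> xs"
    by (simp add: coboundary_def restrict_chain_def)
qed

lemma restrict_coboundary:
  assumes "L \<subseteq> M"
  shows "restrict_chain L (coboundary M \<phi>) = coboundary L \<phi>"
  using assms by (intro ext) (auto simp: coboundary_def restrict_chain_def)

lemma coboundary_coboundary:
  assumes "\<forall>\<sigma>\<in>L. \<forall>\<tau>. \<tau> \<subseteq> \<sigma> \<longrightarrow> \<tau> \<in> L" "alternating \<phi>"
  shows "coboundary L (coboundary L \<phi>) = (\<lambda>xs. 0)"
proof -
  have "coboundary L (coboundary L \<phi>) = coboundary L (deletion_sum \<phi>)"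
    using coboundary_restrict[OF assms(1)] by (simp add: coboundary_eq[OF assms(2)])
  also have "\<dots> = (\<lambda>xs. 0)"
    by (intro ext) (simp add: coboundary_eq alternating_deletion_sum assms(2) restrict_chain_def
        deletion_sum_deletion_sum)
  finally show ?thesis .
qed

lemma alternating_boundary: "alternating c \<Longrightarrow> alternating (boundary V c)"
  unfolding boundary_def
  by (intro alternatingI) (simp only: sum_negf[symmetric], intro sum.cong refl,
      erule alternatingD[of c "_ # _", unfolded append_Cons])

lemma alternating_chain_boundary:
  assumes "\<forall>\<sigma>\<in>K. \<forall>\<tau>. \<tau> \<subseteq> \<sigma> \<longrightarrow> \<tau> \<in> K" "alternating_chain K c"
  shows "alternating_chain K (boundary V c)"
proof -
  have "set ys \<in> K" if "boundary V c ys \<noteq> 0" for ys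
  proof -
    from that have "(\<Sum>v\<in>V. c (v # ys)) \<noteq> 0"
      by (simp add: boundary_def)
    then obtain v where "v \<in> V" "c (v # ys) \<noteq> 0"
      by (rule sum.not_neutral_contains_not_neutral)
    then have "set (v # ys) \<in> K"
      using assms(2) unfolding alternating_chain_def by blast
    then show ?thesis
      using assms(1) by (meson set_subset_Cons)
  qed
  then show ?thesis
    using assms(2) alternating_boundary unfolding alternating_chain_def by blast
qed

lemma has_degree_boundary:
  assumes "has_degree i c"
  shows "has_degree (i - 1) (boundary V c)"
proof -
  have "int (length ys) = i" if "boundary V c ys \<noteq> 0" for ys
  proof -
    from that have "(\<Sum>v\<in>V. c (v # ys)) \<noteq> 0"
      by (simp add: boundary_def)
    then obtain v where "v \<in> V" "c (v # ys) \<noteq> 0"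
      by (rule sum.not_neutral_contains_not_neutral)
    then show ?thesis
      using assms unfolding has_degree_def by fastforce
  qed
  then show ?thesis
    unfolding has_degree_def by auto
qed

lemma boundary_boundary:
  assumes "alternating c"
  shows "boundary V (boundary V c) = (\<lambda>xs. 0)"
proof
  fix ys
  let ?s = "\<Sum>v\<in>V. \<Sum>u\<in>V. c (u # v # ys)"
  have "?s = (\<Sum>v\<in>V. \<Sum>u\<in>V. - c (v # u # ys))"
    by (intro sum.cong refl) (rule alternatingD[OF assms, of "[]", unfolded append_Nil])
  also have "\<dots> = - ?s"
    by (simp add: sum_negf) (rule sum.swap)
  finally show "boundary V (boundary V c) ys = 0"
    by (simp add: boundary_def)
qed

text \<open>Deletion of the first vertex in \<open>deletion_sum c (v # xs)\<close> gives \<open>c xs\<close>, and the other deletions keep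
  \<open>v\<close>. Summed over all \<open>v\<close> in \<open>V\<close>, the former give \<open>card V\<close> copies of \<open>c xs\<close> and the latter
  reproduce \<open>coboundary (boundary c)\<close> with the opposite sign. The formula for the coboundary of \<open>c\<close> may
  be used also for \<open>v\<close> in \<open>xs\<close>, because it is alternating and hence vanishes on lists with repetitions.\<close>

lemma laplacian_full_simplex:
  assumes "alternating_chain (Pow V) c"
  shows "boundary V (coboundary (Pow V) c) xs + coboundary (Pow V) (boundary V c) xs
    = of_nat (card V) * c xs"
proof (cases "set xs \<subseteq> V")
  case True
  have c: "alternating c"
    using assms by (simp add: alternating_chain_def)
  have "boundary V (coboundary (Pow V) c) xs = (\<Sum>v\<in>V. deletion_sum c (v # xs))"
    using True by (simp add: boundary_def coboundary_eq[OF c] restrict_chain_def)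
  also have "\<dots> = of_nat (card V) * c xs - deletion_sum (boundary V c) xs"
    by (simp add: boundary_def[abs_def] deletion_sum_sum sum_subtractf)
  finally show ?thesis
    using True by (simp add: coboundary_eq[OF alternating_boundary[OF c]] restrict_chain_def)
next
  case False
  then have "c xs = 0"
    using assms unfolding alternating_chain_def by blast
  then show ?thesis
    using False by (simp add: boundary_def coboundary_def)
qed

section \<open>The star operator\<close>

locale oriented_vertex_set =
  fixes V :: "'a set" and \<omega> :: "'a list \<Rightarrow> complex"
  assumes finite_V: "finite V"
    and alternating_orientation: "alternating \<omega>"
    and orientation_square: "\<lbrakk>distinct zs; set zs = V\<rbrakk> \<Longrightarrow> \<omega> zs * \<omega> zs = 1"
begin

text \<open>Any enumeration will do: the star of an alternating function does not depend on it (\<open>star_eq\<close>).\<close>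

definition complement_list :: "'a set \<Rightarrow> 'a list" where
  "complement_list \<sigma> = (SOME xs. distinct xs \<and> set xs = V - \<sigma>)"

lemma complement_list: "distinct (complement_list \<sigma>)" "set (complement_list \<sigma>) = V - \<sigma>"
proof -
  have "\<exists>xs. distinct xs \<and> set xs = V - \<sigma>"
    using finite_distinct_list[of "V - \<sigma>"] finite_V by auto
  from someI_ex[OF this] show "distinct (complement_list \<sigma>)" "set (complement_list \<sigma>) = V - \<sigma>"
    unfolding complement_list_def by auto
qed

text \<open>The first block is reversed so that its first vertex stands next to the second block. A vertex
  can then pass from one block to the other without a sign, and \<open>star_boundary\<close> holds with no sign that
  depends on the degree.\<close>

definition star :: "('a list \<Rightarrow> complex) \<Rightarrow> 'a list \<Rightarrow> complex" where
  "star c ys = (if distinct ys \<and> set ys \<subseteq> V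
     then c (complement_list (set ys)) * \<omega> (rev (complement_list (set ys)) @ ys) else 0)"

text \<open>A change of the enumeration of the complement multiplies both factors by the sign of the same
  permutation.\<close>

lemma star_eq:
  assumes "alternating c" "distinct ys" "set ys \<subseteq> V" "distinct xs" "set xs = V - set ys"
  shows "star c ys = c xs * \<omega> (rev xs @ ys)"
proof -
  let ?zs = "complement_list (set ys)"
  have "mset xs = mset ?zs"
    using set_eq_iff_mset_eq_distinct[of xs ?zs] complement_list[of "set ys"] assms(4,5) by simp
  then obtain p where p: "p permutes {..<length ?zs}" "permute_list p ?zs = xs"
    using mset_eq_permutation by blast
  have "c xs = of_int (sign p) * c ?zs"
    using alternating_permute_list[OF assms(1) p(1)] p(2) by simp
  moreover have "\<omega> (rev xs @ ys) = of_int (sign p) * \<omega> (rev ?zs @ ys)"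
    using alternating_permute_list[OF alternating_rev_suffix[OF alternating_orientation] p(1)] p(2)
    by simp
  moreover have "of_int (sign p) * of_int (sign p) = (1 :: complex)"
    by (metis of_int_1 of_int_mult sign_idempotent)
  ultimately show ?thesis
    using assms(2,3) by (simp add: star_def algebra_simps)
qed

lemma alternating_star: "alternating (star c)"
  unfolding alternating_def
proof (intro allI)
  fix as bs and u v :: 'a
  let ?zs = "rev (complement_list (set (as @ u # v # bs)))"
  have "\<omega> (?zs @ as @ v # u # bs) = - \<omega> (?zs @ as @ u # v # bs)"
    by (metis alternatingD alternating_orientation append.assoc)
  moreover have "distinct (as @ v # u # bs) = distinct (as @ u # v # bs)"
    by auto
  ultimately show "star c (as @ v # u # bs) = - star c (as @ u # v # bs)"
    unfolding star_def set_swap[of as v u bs] by simp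
qed

lemma alternating_chain_star: "alternating_chain (Pow V) (star c)"
  using alternating_star by (auto simp: alternating_chain_def star_def)

lemma has_degree_star:
  assumes "has_degree i c"
  shows "has_degree (int (card V) - i - 2) (star c)"
proof -
  have "int (length ys) = int (card V) - i - 1" if "star c ys \<noteq> 0" for ys
  proof -
    let ?zs = "complement_list (set ys)"
    from that have ys: "distinct ys" "set ys \<subseteq> V" and "c ?zs \<noteq> 0"
      unfolding star_def by (auto split: if_splits)
    then have "int (length ?zs) = i + 1"
      using assms unfolding has_degree_def by blast
    moreover have "length ?zs + length ys = card V"
      using complement_list[of "set ys"] ys finite_V
      by (metis card_Diff_subset card_mono distinct_card finite_set le_add_diff_inverse2)
    ultimately show ?thesis
      by linarith
  qed
  then show ?thesis
    unfolding has_degree_def by auto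
qed

text \<open>The factor is the sign of the reversal of a list of length \<open>card V\<close>, since the two stars evaluate
  \<open>\<omega>\<close> on a list and on its reverse.\<close>

lemma star_star:
  assumes "alternating_chain (Pow V) c"
  shows "star (star c) = (\<lambda>xs. (-1) ^ (\<Sum>k<card V. k) * c xs)"
proof
  fix xs
  show "star (star c) xs = (-1) ^ (\<Sum>k<card V. k) * c xs"
  proof (cases "distinct xs \<and> set xs \<subseteq> V")
    case True
    let ?ys = "complement_list (set xs)"
    have ys: "distinct ?ys" "set ?ys = V - set xs"
      using complement_list by auto
    have c: "alternating c"
      using assms by (simp add: alternating_chain_def)
    have zs: "distinct (rev xs @ ?ys)" "set (rev xs @ ?ys) = V"
      using True ys by auto
    have "star c ?ys = c xs * \<omega> (rev xs @ ?ys)"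
      using True ys by (intro star_eq[OF c]) auto
    moreover have "\<omega> (rev ?ys @ xs) = (-1) ^ (\<Sum>k<card V. k) * \<omega> (rev xs @ ?ys)"
      using alternating_rev[OF alternating_orientation, of "rev xs @ ?ys"] distinct_card[OF zs(1)]
        zs(2) by simp
    moreover have "star (star c) xs = star c ?ys * \<omega> (rev ?ys @ xs)"
      using True by (simp add: star_def)
    ultimately show ?thesis
      using orientation_square[OF zs] by (simp add: mult.assoc mult.left_commute)
  next
    case False
    moreover have "c xs = 0"
      using False assms alternating_not_distinct unfolding alternating_chain_def by blast
    ultimately show ?thesis
      by (auto simp: star_def)
  qed
qed

text \<open>Both sides are sums over the vertices \<open>v\<close> of \<open>ys\<close>: on the left \<open>v\<close> is added to the complement,
  where a vertex outside of \<open>ys\<close> would be a repetition, and on the right \<open>v\<close> is deleted from \<open>ys\<close>. The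
  sign of the deletion of \<open>v\<close> at place \<open>j\<close> is the sign of the move of \<open>v\<close> over the first \<open>j\<close> entries
  inside \<open>\<omega>\<close>.\<close>

lemma star_boundary:
  assumes "alternating c"
  shows "star (boundary V c) = coboundary (Pow V) (star c)"
proof
  fix ys
  show "star (boundary V c) ys = coboundary (Pow V) (star c) ys"
  proof (cases "distinct ys \<and> set ys \<subseteq> V")
    case False
    then show ?thesis
      by (auto simp: star_def coboundary_def)
  next
    case True
    then have ys: "distinct ys" "set ys \<subseteq> V"
      by auto
    let ?xs = "complement_list (set ys)"
    have xs: "distinct ?xs" "set ?xs = V - set ys"
      using complement_list by auto
    let ?w = "\<omega> (rev ?xs @ ys)"
    have "(\<Sum>v\<in>V. c (v # ?xs)) = (\<Sum>v\<in>set ys. c (v # ?xs))"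
      using ys xs finite_V alternating_not_distinct[OF assms]
      by (intro sum.mono_neutral_right) auto
    also have "\<dots> = (\<Sum>j<length ys. c (ys ! j # ?xs))"
      using sum.reindex_bij_betw[OF bij_betw_nth[OF ys(1) refl refl], of "\<lambda>v. c (v # ?xs)"] by simp
    finally have "star (boundary V c) ys = (\<Sum>j<length ys. c (ys ! j # ?xs) * ?w)"
      using True by (simp add: star_def boundary_def sum_distrib_right)
    also have "\<dots> = (\<Sum>j<length ys. (-1) ^ j * star c (delete_nth j ys))"
    proof (rule sum.cong[OF refl])
      fix j assume "j \<in> {..<length ys}"
      then have j: "j < length ys"
        by simp
      define as v bs where "as = take j ys" and "v = ys ! j" and "bs = drop (Suc j) ys"
      have split: "ys = as @ v # bs" and del: "delete_nth j ys = as @ bs" and len: "length as = j"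
        using id_take_nth_drop[OF j] j unfolding as_def v_def bs_def delete_nth_def by auto
      have "distinct (v # ?xs)" "set (v # ?xs) = V - set (as @ bs)"
        using ys xs split by auto
      then have "star c (as @ bs) = c (v # ?xs) * \<omega> (rev (v # ?xs) @ as @ bs)"
        using ys split by (intro star_eq[OF assms]) auto
      moreover have "?w = (-1) ^ j * \<omega> (rev (v # ?xs) @ as @ bs)"
        using alternating_move[OF alternating_orientation, of "rev ?xs" as v bs] len
        by (simp add: split[symmetric])
      ultimately show "c (ys ! j # ?xs) * ?w = (-1) ^ j * star c (delete_nth j ys)"
        by (simp add: del v_def)
    qed
    finally show ?thesis
      using True by (simp add: coboundary_def)
  qed
qed

text \<open>The sign arises because \<open>\<omega>\<close>, evaluated on an enumeration of \<open>V\<close>, is multiplied by \<open>sign g\<close>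
  when \<open>g\<close> is applied to the entries.\<close>

lemma star_chain_act:
  assumes "alternating c" "g permutes V"
  shows "star (chain_act g c) = (\<lambda>ys. of_int (sign g) * chain_act g (star c) ys)"
proof
  fix ys
  let ?h = "inv_into UNIV g"
  have h: "?h permutes V"
    using assms(2) by (rule permutes_inv)
  then have inj: "inj ?h"
    by (rule permutes_inj)
  show "star (chain_act g c) ys = of_int (sign g) * chain_act g (star c) ys"
  proof (cases "distinct ys \<and> set ys \<subseteq> V")
    case False
    then have "\<not> (distinct (map ?h ys) \<and> set (map ?h ys) \<subseteq> V)"
      using inj permutes_in_image[OF h] by (auto simp: distinct_map inj_on_subset)
    then show ?thesis
      using False by (auto simp: star_def chain_act_def)
  next
    case True
    let ?xs = "complement_list (set ys)"
    have xs: "distinct ?xs" "set ?xs = V - set ys"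
      using complement_list by auto
    have "set (map ?h ?xs) = V - set (map ?h ys)"
      using xs permutes_image[OF h] image_set_diff[OF inj, of V "set ys"] by simp
    then have "star c (map ?h ys) = c (map ?h ?xs) * \<omega> (rev (map ?h ?xs) @ map ?h ys)"
      using True xs permutes_in_image[OF h] inj_on_subset[OF inj subset_UNIV]
      by (intro star_eq[OF assms(1)]) (auto simp: distinct_map)
    also have "rev (map ?h ?xs) @ map ?h ys = map ?h (rev ?xs @ ys)"
      by (simp add: rev_map)
    also have "\<omega> \<dots> = of_int (sign ?h) * \<omega> (rev ?xs @ ys)"
    proof (rule alternating_map_permutes[OF alternating_orientation])
      have "set (rev ?xs @ ys) = V"
        using True xs by auto
      then show "?h permutes set (rev ?xs @ ys)"
        using h by simp
    qed (use True xs in auto)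
    also have "sign ?h = sign g"
      using assms(2) finite_V by (meson permutation_permutes sign_inverse)
    finally have "star c (map ?h ys) = of_int (sign g) * (c (map ?h ?xs) * \<omega> (rev ?xs @ ys))"
      by simp
    moreover have "of_int (sign g) * of_int (sign g) = (1 :: complex)"
      by (metis of_int_1 of_int_mult sign_idempotent)
    ultimately show ?thesis
      using True by (simp add: star_def chain_act_def mult.assoc[symmetric])
  qed
qed

end

section \<open>Linear operators on chains\<close>

definition linear_operator :: "(('a list \<Rightarrow> complex) \<Rightarrow> ('b list \<Rightarrow> complex)) \<Rightarrow> bool" where
  "linear_operator T \<longleftrightarrow>
    (\<forall>a b c d. T (\<lambda>xs. a * c xs + b * d xs) = (\<lambda>ys. a * T c ys + b * T d ys))"

definition chain_subspace :: "('a list \<Rightarrow> complex) set \<Rightarrow> bool" where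
  "chain_subspace C \<longleftrightarrow>
    C \<noteq> {} \<and> (\<forall>a b. \<forall>c\<in>C. \<forall>d\<in>C. (\<lambda>xs. a * c xs + b * d xs) \<in> C)"

lemma linear_operatorD:
  "linear_operator T \<Longrightarrow> T (\<lambda>xs. a * c xs + b * d xs) = (\<lambda>ys. a * T c ys + b * T d ys)"
  unfolding linear_operator_def by blast

lemma linear_operator_rules:
  assumes "linear_operator T"
  shows "T (\<lambda>xs. 0) = (\<lambda>ys. 0)" "T (\<lambda>xs. a * c xs) = (\<lambda>ys. a * T c ys)"
    "T (\<lambda>xs. c xs + d xs) = (\<lambda>ys. T c ys + T d ys)"
    "T (\<lambda>xs. c xs - d xs) = (\<lambda>ys. T c ys - T d ys)"
    "T (\<lambda>xs. - c xs) = (\<lambda>ys. - T c ys)"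
  using linear_operatorD[OF assms, of 0 c 0 c] linear_operatorD[OF assms, of a c 0 c]
    linear_operatorD[OF assms, of 1 c 1 d] linear_operatorD[OF assms, of 1 c "-1" d]
    linear_operatorD[OF assms, of "-1" c 0 c]
  by simp_all

lemma chain_subspace_rules:
  assumes "chain_subspace C"
  shows "(\<lambda>xs. 0) \<in> C" "c \<in> C \<Longrightarrow> (\<lambda>xs. a * c xs) \<in> C"
    "c \<in> C \<Longrightarrow> d \<in> C \<Longrightarrow> (\<lambda>xs. c xs + d xs) \<in> C"
    "c \<in> C \<Longrightarrow> d \<in> C \<Longrightarrow> (\<lambda>xs. c xs - d xs) \<in> C"
    "c \<in> C \<Longrightarrow> (\<lambda>xs. - c xs) \<in> C"
proof -
  have comb: "(\<lambda>xs. a * c xs + b * d xs) \<in> C" if "c \<in> C" "d \<in> C" for a b c d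
    using assms that unfolding chain_subspace_def by blast
  obtain c0 where "c0 \<in> C"
    using assms unfolding chain_subspace_def by blast
  then show "(\<lambda>xs. 0) \<in> C"
    using comb[of c0 c0 0 0] by simp
  show "c \<in> C \<Longrightarrow> (\<lambda>xs. a * c xs) \<in> C"
    using comb[of c c a 0] by simp
  show "c \<in> C \<Longrightarrow> d \<in> C \<Longrightarrow> (\<lambda>xs. c xs + d xs) \<in> C"
    using comb[of c d 1 1] by simp
  show "c \<in> C \<Longrightarrow> d \<in> C \<Longrightarrow> (\<lambda>xs. c xs - d xs) \<in> C"
    using comb[of c d 1 "-1"] by simp
  show "c \<in> C \<Longrightarrow> (\<lambda>xs. - c xs) \<in> C"
    using comb[of c c "-1" 0] by simp
qed

lemma chain_subspace_image:
  assumes "chain_subspace C" "linear_operator T"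
  shows "chain_subspace (T ` C)"
proof -
  have "(\<lambda>ys. a * T c ys + b * T d ys) \<in> T ` C" if "c \<in> C" "d \<in> C" for a b c d
    using linear_operatorD[OF assms(2), of a c b d, symmetric] assms(1) that
    unfolding chain_subspace_def by simp
  then show ?thesis
    using assms(1) unfolding chain_subspace_def by blast
qed

lemma chain_subspace_kernel:
  assumes "chain_subspace C" "linear_operator T"
  shows "chain_subspace {c \<in> C. T c = (\<lambda>ys. 0)}"
  using assms chain_subspace_rules(1)[OF assms(1)] linear_operator_rules(1)[OF assms(2)]
  by (auto simp: chain_subspace_def linear_operatorD)

lemma linear_operator_boundary: "linear_operator (boundary V)"
  unfolding linear_operator_def boundary_def by (simp add: sum.distrib sum_distrib_left)

lemma linear_operator_coboundary: "linear_operator (coboundary K)"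
  unfolding linear_operator_def coboundary_def
  by (auto simp: fun_eq_iff sum.distrib sum_distrib_left algebra_simps)

lemma linear_operator_restrict: "linear_operator (restrict_chain K)"
  unfolding linear_operator_def restrict_chain_def by auto

lemma linear_operator_comp:
  "linear_operator S \<Longrightarrow> linear_operator T \<Longrightarrow> linear_operator (\<lambda>c. S (T c))"
  unfolding linear_operator_def by simp

lemma (in oriented_vertex_set) linear_operator_star: "linear_operator star"
  unfolding linear_operator_def by (auto simp: star_def fun_eq_iff algebra_simps)

lemma chain_subspace_oriented_chains: "chain_subspace (oriented_chains K i)"
proof -
  have "(\<lambda>xs. 0) \<in> oriented_chains K i"
    by (simp add: oriented_chains_def)
  moreover have "(\<lambda>xs. a * c xs + b * d xs) \<in> oriented_chains K i"
    if c: "c \<in> oriented_chains K i" and d: "d \<in> oriented_chains K i" for a b c d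
  proof -
    have "a * c xs + b * d xs \<noteq> 0 \<Longrightarrow> c xs \<noteq> 0 \<or> d xs \<noteq> 0" for xs
      by auto
    then show ?thesis
      using c d unfolding oriented_chains_def by (fastforce simp: algebra_simps)
  qed
  ultimately show ?thesis
    unfolding chain_subspace_def by blast
qed

section \<open>The duality map on chains\<close>

locale alexander_duality = oriented_vertex_set +
  fixes K :: "'a set set"
  assumes complex: "simplicial_complex V K" and nonempty: "V \<noteq> {}"
begin

abbreviation "dual \<equiv> alexander_dual V K"

lemma K_closed: "\<forall>\<sigma>\<in>K. \<forall>\<tau>. \<tau> \<subseteq> \<sigma> \<longrightarrow> \<tau> \<in> K" and K_subset: "K \<subseteq> Pow V"
  using complex by (auto simp: simplicial_complex_def)

lemma dual_subset: "dual \<subseteq> Pow V"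
  by (auto simp: alexander_dual_def)

lemma dual_closed: "\<forall>\<sigma>\<in>dual. \<forall>\<tau>. \<tau> \<subseteq> \<sigma> \<longrightarrow> \<tau> \<in> dual"
proof (intro ballI allI impI)
  fix \<sigma> \<tau> assume "\<sigma> \<in> dual" "\<tau> \<subseteq> \<sigma>"
  moreover from this have "V - \<sigma> \<subseteq> V - \<tau>"
    by blast
  ultimately show "\<tau> \<in> dual"
    using K_closed unfolding alexander_dual_def by blast
qed

text \<open>A simplex lies in the dual exactly if its complement is not in \<open>K\<close>, and the star of a chain has
  on a simplex, up to sign, the value of the chain on the complement.\<close>

lemma restrict_star_eq_0_iff:
  assumes "alternating_chain (Pow V) c"
  shows "restrict_chain dual (star c) = (\<lambda>ys. 0) \<longleftrightarrow> alternating_chain K c"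
proof
  assume zero: "restrict_chain dual (star c) = (\<lambda>ys. 0)"
  have "set xs \<in> K" if "c xs \<noteq> 0" for xs
  proof (rule ccontr)
    assume "set xs \<notin> K"
    let ?ys = "complement_list (set xs)"
    have xs: "distinct xs" "set xs \<subseteq> V"
      using that assms alternating_not_distinct unfolding alternating_chain_def by blast+
    have ys: "distinct ?ys" "set ?ys = V - set xs"
      using complement_list by auto
    have "V - set ?ys = set xs"
      using xs ys by auto
    then have "set ?ys \<in> dual"
      using \<open>set xs \<notin> K\<close> ys by (simp add: alexander_dual_def)
    then have "star c ?ys = 0"
      using fun_cong[OF zero, of ?ys] by (simp add: restrict_chain_def)
    moreover have "star c ?ys = c xs * \<omega> (rev xs @ ?ys)"
      using xs ys assms by (intro star_eq) (auto simp: alternating_chain_def)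
    moreover have "\<omega> (rev xs @ ?ys) \<noteq> 0"
    proof -
      have "set (rev xs @ ?ys) = V"
        using xs ys by auto
      then show ?thesis
        using orientation_square[of "rev xs @ ?ys"] xs ys by auto
    qed
    ultimately show False
      using that by simp
  qed
  then show "alternating_chain K c"
    using assms unfolding alternating_chain_def by blast
next
  assume c: "alternating_chain K c"
  show "restrict_chain dual (star c) = (\<lambda>ys. 0)"
  proof
    fix ys
    have "V - set ys \<in> K" if "star c ys \<noteq> 0"
    proof -
      have "c (complement_list (set ys)) \<noteq> 0"
        using that unfolding star_def by (auto split: if_splits)
      then have "set (complement_list (set ys)) \<in> K"
        using c unfolding alternating_chain_def by blast
      then show ?thesis
        by (simp add: complement_list)
    qed
    then show "restrict_chain dual (star c) ys = 0"
      unfolding restrict_chain_def alexander_dual_def by auto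
  qed
qed

text \<open>Restriction to the dual is a map of cochain complexes because the dual is closed under subsets.
  With \<open>star_boundary\<close> it follows that star, followed by the restriction, turns the boundary of the full
  simplex into the coboundary of the dual.\<close>

lemma coboundary_restrict_star:
  assumes "alternating c"
  shows "coboundary dual (restrict_chain dual (star c)) = restrict_chain dual (star (boundary V c))"
  by (simp add: coboundary_restrict[OF dual_closed] star_boundary[OF assms]
      restrict_coboundary[OF dual_subset])

text \<open>Up to the factor \<open>card V\<close>, a cycle is filled in the full simplex by its coboundary there. The
  star of this filling is a cochain whose restriction to the dual depends only on the filling modulo
  chains of \<open>K\<close>.\<close>

definition duality_map :: "('a list \<Rightarrow> complex) \<Rightarrow> 'a list \<Rightarrow> complex" where
  "duality_map c = restrict_chain dual (star (coboundary (Pow V) c))"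

lemma linear_operator_duality_map: "linear_operator duality_map"
  unfolding duality_map_def[abs_def]
  by (intro linear_operator_comp[OF linear_operator_restrict]
      linear_operator_comp[OF linear_operator_star] linear_operator_coboundary)

lemma duality_map_in_chains:
  assumes "c \<in> oriented_chains M i"
  shows "duality_map c \<in> oriented_chains dual (int (card V) - i - 3)"
proof -
  have "has_degree (int (card V) - (i + 1) - 2) (star (coboundary (Pow V) c))"
    using assms by (intro has_degree_star has_degree_coboundary) (simp add: oriented_chains_iff)
  then have "has_degree (int (card V) - i - 3) (star (coboundary (Pow V) c))"
    by (simp add: algebra_simps)
  then show ?thesis
    unfolding oriented_chains_iff duality_map_def
    using has_degree_restrict alternating_chain_restrict[OF alternating_star] by blast
qed

abbreviation "vertex_count \<equiv> of_nat (card V) :: complex"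

lemma card_nonzero: "vertex_count \<noteq> 0"
  using nonempty finite_V by simp

lemma coboundary_boundary:
  assumes "alternating_chain (Pow V) c"
  shows "coboundary (Pow V) (boundary V c)
    = (\<lambda>xs. vertex_count * c xs - boundary V (coboundary (Pow V) c) xs)"
  using laplacian_full_simplex[OF assms] by (auto simp: fun_eq_iff algebra_simps)

text \<open>For a chain of \<open>K\<close> the first term vanishes, so boundaries go to coboundaries. For the star preimage
  of a cocycle of the dual it is, up to the factor \<open>card V\<close>, that cocycle, so the same identity gives
  surjectivity.\<close>

lemma duality_map_boundary:
  assumes "alternating_chain (Pow V) c"
  shows "duality_map (boundary V c) =
    (\<lambda>ys. vertex_count * restrict_chain dual (star c) ys
      - coboundary dual (restrict_chain dual (star (coboundary (Pow V) c))) ys)"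
proof -
  have "alternating (coboundary (Pow V) c)"
    using assms alternating_chain_coboundary unfolding alternating_chain_def by blast
  then show ?thesis
    by (simp add: duality_map_def coboundary_boundary[OF assms] coboundary_restrict_star
        linear_operator_rules[OF linear_operator_star]
        linear_operator_rules[OF linear_operator_restrict])
qed

lemma boundary_coboundary_cycle:
  assumes "alternating_chain (Pow V) c" "boundary V c = (\<lambda>ys. 0)"
  shows "boundary V (coboundary (Pow V) c) = (\<lambda>xs. vertex_count * c xs)"
  using coboundary_boundary[OF assms(1)] assms(2)
    linear_operator_rules(1)[OF linear_operator_coboundary, of "Pow V"]
  by (auto simp: fun_eq_iff)

lemma coboundary_duality_map:
  assumes "alternating_chain K c" "boundary V c = (\<lambda>ys. 0)"
  shows "coboundary dual (duality_map c) = (\<lambda>ys. 0)"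
proof -
  have c: "alternating_chain (Pow V) c"
    using assms(1) alternating_chain_mono[OF K_subset] by blast
  then have "alternating (coboundary (Pow V) c)"
    using alternating_chain_coboundary unfolding alternating_chain_def by blast
  then show ?thesis
    using restrict_star_eq_0_iff[OF c] assms(1)
    by (simp add: duality_map_def coboundary_restrict_star boundary_coboundary_cycle[OF c assms(2)]
        linear_operator_rules[OF linear_operator_star]
        linear_operator_rules[OF linear_operator_restrict])
qed

lemma ex_star_preimage:
  assumes "\<psi> \<in> oriented_chains dual j"
  obtains c where "alternating_chain (Pow V) c" "has_degree (int (card V) - j - 2) c"
    "star c = \<psi>" "restrict_chain dual (star c) = \<psi>"
proof
  let ?s = "(-1) ^ (\<Sum>k<card V. k) :: complex"
  let ?c = "\<lambda>xs. ?s * star \<psi> xs"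
  have \<psi>: "alternating_chain dual \<psi>" "has_degree j \<psi>"
    using assms by (auto simp: oriented_chains_iff)
  show "alternating_chain (Pow V) ?c"
    using alternating_chain_star[of \<psi>] alternating_smult unfolding alternating_chain_def by auto
  show "has_degree (int (card V) - j - 2) ?c"
    using has_degree_star[OF \<psi>(2)] unfolding has_degree_def by auto
  have "?s * (?s * z) = z" for z
    by (simp add: mult.assoc[symmetric] power_add[symmetric] mult_2[symmetric])
  then show "star ?c = \<psi>"
    using star_star[OF alternating_chain_mono[OF dual_subset \<psi>(1)]]
    by (simp add: linear_operator_rules[OF linear_operator_star])
  then show "restrict_chain dual (star ?c) = \<psi>"
    by (simp add: restrict_chain_ident[OF \<psi>(1)])
qed

lemma duality_map_coboundary_iff:
  assumes c: "c \<in> oriented_chains K i" and cycle: "boundary V c = (\<lambda>ys. 0)"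
  shows "duality_map c \<in> coboundary dual ` oriented_chains dual (int (card V) - i - 4)
    \<longleftrightarrow> c \<in> boundary V ` oriented_chains K (i + 1)"
proof
  assume "c \<in> boundary V ` oriented_chains K (i + 1)"
  then obtain e where e: "e \<in> oriented_chains K (i + 1)" and ce: "c = boundary V e"
    by blast
  have K: "alternating_chain K e" and V: "alternating_chain (Pow V) e"
    using e alternating_chain_mono[OF K_subset] by (auto simp: oriented_chains_iff)
  let ?\<psi> = "duality_map e"
  have "?\<psi> \<in> oriented_chains dual (int (card V) - i - 4)"
    using duality_map_in_chains[OF e] by (simp add: algebra_simps)
  then have "(\<lambda>ys. - ?\<psi> ys) \<in> oriented_chains dual (int (card V) - i - 4)"
    by (rule chain_subspace_rules[OF chain_subspace_oriented_chains])
  moreover have "duality_map c = coboundary dual (\<lambda>ys. - ?\<psi> ys)"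
    using restrict_star_eq_0_iff[OF V] K
    by (simp add: ce duality_map_boundary[OF V] linear_operator_rules[OF linear_operator_coboundary])
      (simp add: duality_map_def)
  ultimately show "duality_map c \<in> coboundary dual ` oriented_chains dual (int (card V) - i - 4)"
    by blast
next
  assume "duality_map c \<in> coboundary dual ` oriented_chains dual (int (card V) - i - 4)"
  then obtain \<psi> where \<psi>: "\<psi> \<in> oriented_chains dual (int (card V) - i - 4)"
    and eq: "duality_map c = coboundary dual \<psi>"
    by blast
  \<comment> \<open>The chain \<open>e\<close> with star \<open>\<psi>\<close> corrects the filling \<open>\<delta> c\<close>: the difference \<open>\<delta> c - \<partial> e\<close> has the same
    boundary as \<open>\<delta> c\<close>, and it is a chain of \<open>K\<close> because its star vanishes on the dual.\<close>
  obtain e where e: "alternating_chain (Pow V) e" "has_degree (i + 2) e"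
    and \<psi>_e: "restrict_chain dual (star e) = \<psi>"
    using ex_star_preimage[OF \<psi>] by (auto simp: algebra_simps)
  have cV: "alternating_chain (Pow V) c"
    using c alternating_chain_mono[OF K_subset] by (auto simp: oriented_chains_iff)
  define w where "w = (\<lambda>xs. coboundary (Pow V) c xs - boundary V e xs)"
  have "coboundary (Pow V) c \<in> oriented_chains (Pow V) (i + 1)"
    using c cV alternating_chain_coboundary[of c "Pow V"] has_degree_coboundary[of i c "Pow V"]
    unfolding oriented_chains_iff alternating_chain_def by blast
  moreover have "boundary V e \<in> oriented_chains (Pow V) (i + 1)"
    using alternating_chain_boundary[OF _ e(1), of V] has_degree_boundary[OF e(2), of V]
    by (auto simp: oriented_chains_iff algebra_simps)
  ultimately have w: "w \<in> oriented_chains (Pow V) (i + 1)"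
    unfolding w_def by (rule chain_subspace_rules[OF chain_subspace_oriented_chains])
  have "restrict_chain dual (star (boundary V e)) = coboundary dual \<psi>"
    using e(1) coboundary_restrict_star \<psi>_e unfolding alternating_chain_def by auto
  then have "restrict_chain dual (star w) = (\<lambda>ys. 0)"
    using eq by (simp add: w_def duality_map_def linear_operator_rules[OF linear_operator_star]
        linear_operator_rules[OF linear_operator_restrict])
  then have "w \<in> oriented_chains K (i + 1)"
    using w restrict_star_eq_0_iff by (simp add: oriented_chains_iff)
  then have "(\<lambda>xs. (1 / vertex_count) * w xs) \<in> oriented_chains K (i + 1)"
    by (rule chain_subspace_rules[OF chain_subspace_oriented_chains])
  moreover have "boundary V (boundary V e) = (\<lambda>ys. 0)"
    using e(1) boundary_boundary unfolding alternating_chain_def by blast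
  then have "boundary V w = (\<lambda>xs. vertex_count * c xs)"
    by (simp add: w_def linear_operator_rules[OF linear_operator_boundary]
        boundary_coboundary_cycle[OF cV cycle])
  then have "c = boundary V (\<lambda>xs. (1 / vertex_count) * w xs)"
    unfolding linear_operator_rules(2)[OF linear_operator_boundary] using card_nonzero by simp
  ultimately show "c \<in> boundary V ` oriented_chains K (i + 1)"
    by blast
qed

lemma duality_map_onto:
  assumes \<phi>: "\<phi> \<in> oriented_chains dual (int (card V) - i - 3)"
    and cocycle: "coboundary dual \<phi> = (\<lambda>xs. 0)"
  shows "\<exists>c\<in>{c \<in> oriented_chains K i. boundary V c = (\<lambda>ys. 0)}.
    (\<lambda>ys. \<phi> ys - duality_map c ys) \<in> coboundary dual ` oriented_chains dual (int (card V) - i - 4)"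
proof -
  obtain b where b: "alternating_chain (Pow V) b" "has_degree (i + 1) b"
    and \<phi>_b: "restrict_chain dual (star b) = \<phi>"
    using ex_star_preimage[OF \<phi>] by (auto simp: algebra_simps)
  \<comment> \<open>The boundary of \<open>b'\<close> will be the preimage. It is a chain of \<open>K\<close> because its star restricts to the
    coboundary of \<open>\<phi>/n\<close>, which is zero. The division compensates the factor in \<open>duality_map_boundary\<close>.\<close>
  define b' where "b' = (\<lambda>xs. (1 / vertex_count) * b xs)"
  have b'_chain: "b' \<in> oriented_chains (Pow V) (i + 1)"
    unfolding b'_def using b
    by (intro chain_subspace_rules[OF chain_subspace_oriented_chains]) (simp add: oriented_chains_iff)
  then have b': "alternating_chain (Pow V) b'" "alternating b'" "has_degree (i + 1) b'"
    by (auto simp: oriented_chains_iff alternating_chain_def)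
  have star_b': "restrict_chain dual (star b') = (\<lambda>ys. (1 / vertex_count) * \<phi> ys)"
    unfolding b'_def linear_operator_rules(2)[OF linear_operator_star]
      linear_operator_rules(2)[OF linear_operator_restrict] \<phi>_b ..
  have "coboundary dual (restrict_chain dual (star b')) = (\<lambda>ys. 0)"
    unfolding star_b' linear_operator_rules(2)[OF linear_operator_coboundary] cocycle by simp
  then have "restrict_chain dual (star (boundary V b')) = (\<lambda>ys. 0)"
    using coboundary_restrict_star[OF b'(2)] by simp
  moreover have "alternating_chain (Pow V) (boundary V b')"
    using alternating_chain_boundary[OF _ b'(1)] by auto
  ultimately have "boundary V b' \<in> {c \<in> oriented_chains K i. boundary V c = (\<lambda>ys. 0)}"
    using restrict_star_eq_0_iff has_degree_boundary[OF b'(3), of V] boundary_boundary[OF b'(2)]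
    by (simp add: oriented_chains_iff)
  moreover have "duality_map b' \<in> oriented_chains dual (int (card V) - i - 4)"
    using duality_map_in_chains[OF b'_chain] by (simp add: algebra_simps)
  moreover have "(\<lambda>ys. \<phi> ys - duality_map (boundary V b') ys) = coboundary dual (duality_map b')"
    using card_nonzero by (simp add: duality_map_boundary[OF b'(1)] star_b' duality_map_def[of b'])
  ultimately show ?thesis
    by (intro bexI[of _ "boundary V b'"]) auto
qed

end


section \<open>Symmetries\<close>

lemma chain_act_boundary:
  assumes "g permutes V"
  shows "boundary V (chain_act g c) = chain_act g (boundary V c)"
proof
  fix ys
  have "bij_betw (inv_into UNIV g) V V"
    using permutes_inv[OF assms] by (rule permutes_imp_bij)
  then show "boundary V (chain_act g c) ys = chain_act g (boundary V c) ys"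
    using sum.reindex_bij_betw[of "inv_into UNIV g" V V "\<lambda>v. c (v # map (inv_into UNIV g) ys)"]
    by (simp add: boundary_def chain_act_def)
qed

text \<open>Both directions are demanded so that \<open>g\<close> and its inverse can be treated alike, and so that the
  property passes to the Alexander dual, whose definition involves non-membership in \<open>K\<close>.\<close>

definition preserves :: "('a \<Rightarrow> 'a) \<Rightarrow> 'a set set \<Rightarrow> bool" where
  "preserves g K \<longleftrightarrow> bij g \<and> (\<forall>\<sigma>. g ` \<sigma> \<in> K \<longleftrightarrow> \<sigma> \<in> K)"

lemma preserves_inv:
  assumes "preserves g K"
  shows "inv_into UNIV g ` \<sigma> \<in> K \<longleftrightarrow> \<sigma> \<in> K"
proof -
  have "g ` inv_into UNIV g ` \<sigma> = \<sigma>"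
    using assms by (simp add: preserves_def bij_is_surj image_f_inv_f)
  then show ?thesis
    using assms unfolding preserves_def by metis
qed

lemma chain_act_restrict:
  "preserves g K \<Longrightarrow> restrict_chain K (chain_act g c) = chain_act g (restrict_chain K c)"
  by (simp add: restrict_chain_def chain_act_def preserves_inv)

lemma delete_nth_map: "delete_nth j (map f xs) = map f (delete_nth j xs)"
  by (simp add: delete_nth_def take_map drop_map)

lemma chain_act_coboundary:
  assumes "preserves g K"
  shows "coboundary K (chain_act g c) = chain_act g (coboundary K c)"
proof -
  have "inj (inv_into UNIV g)"
    using assms by (simp add: preserves_def bij_imp_bij_inv bij_is_inj)
  then have "distinct (map (inv_into UNIV g) xs) \<longleftrightarrow> distinct xs" for xs
    by (auto simp: distinct_map intro: inj_on_subset)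
  then show ?thesis
    by (simp add: coboundary_def chain_act_def preserves_inv[OF assms] delete_nth_map cong: if_cong)
qed

lemma chain_act_oriented_chains:
  assumes "preserves g K" "c \<in> oriented_chains K i"
  shows "chain_act g c \<in> oriented_chains K i"
proof -
  have "inj (inv_into UNIV g)"
    using assms by (simp add: preserves_def bij_imp_bij_inv bij_is_inj)
  then have "distinct (map (inv_into UNIV g) xs) \<longleftrightarrow> distinct xs" for xs
    by (auto simp: distinct_map intro: inj_on_subset)
  moreover have "set (map (inv_into UNIV g) xs) \<in> K \<longleftrightarrow> set xs \<in> K" for xs
    by (simp add: preserves_inv[OF assms(1)])
  ultimately show ?thesis
    using assms(2) unfolding oriented_chains_def chain_act_def
    by (auto simp flip: permute_list_map)
qed

lemma preserves_Pow: "g permutes V \<Longrightarrow> preserves g (Pow V)"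
  by (auto simp: preserves_def permutes_bij image_subset_iff permutes_in_image)

lemma preserves_alexander_dual:
  assumes "g permutes V" "preserves g K"
  shows "preserves g (alexander_dual V K)"
proof -
  have "V - g ` \<sigma> = g ` (V - \<sigma>)" for \<sigma>
    using permutes_image[OF assms(1)] image_set_diff[OF permutes_inj[OF assms(1)], of V \<sigma>] by simp
  then show ?thesis
    using assms preserves_Pow[OF assms(1)] by (simp add: alexander_dual_def preserves_def)
qed

lemma (in alexander_duality) duality_map_chain_act:
  assumes "g permutes V" "preserves g K" "alternating c"
  shows "duality_map (chain_act g c) = (\<lambda>ys. of_int (sign g) * chain_act g (duality_map c) ys)"
proof -
  have "alternating (coboundary (Pow V) c)"
    using assms(3) alternating_chain_coboundary unfolding alternating_chain_def by blast
  then show ?thesis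
    using assms(1,2)
    by (simp add: duality_map_def chain_act_coboundary preserves_Pow star_chain_act
        linear_operator_rules[OF linear_operator_restrict] chain_act_restrict
        preserves_alexander_dual)
qed

section \<open>Quotients of modules over a group algebra\<close>

lemma complex_ring_simps [simp]:
  "carrier complex_ring = UNIV" "a \<oplus>\<^bsub>complex_ring\<^esub> b = a + b"
  "a \<otimes>\<^bsub>complex_ring\<^esub> b = a * b" "\<one>\<^bsub>complex_ring\<^esub> = 1" "\<zero>\<^bsub>complex_ring\<^esub> = 0"
  by (simp_all add: complex_ring_def)

lemma cring_complex_ring: "cring complex_ring"
proof (rule cringI)
  have "\<exists>y. y + x = 0" for x :: complex
    by (rule exI[of _ "- x"]) simp
  then show "abelian_group complex_ring"
    by (intro abelian_groupI) simp_all
  show "comm_monoid complex_ring"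
    by (rule comm_monoidI) simp_all
qed (simp add: distrib_right)

locale cg_submodule = cg_module G M for G (structure) and M +
  fixes N
  assumes submodule: "submodule N complex_ring M"
    and act_stable: "\<lbrakk>g \<in> carrier G; x \<in> N\<rbrakk> \<Longrightarrow> act M g x \<in> N"
begin

sublocale N: abelian_subgroup N M
  using submodule by (intro abelian_subgroupI3 additive_subgroupI)
    (auto simp: submodule_def M.abelian_group_axioms)

lemma smult_stable: "x \<in> N \<Longrightarrow> a \<odot>\<^bsub>M\<^esub> x \<in> N"
  using submodule.smult_closed[OF submodule, of a x] by simp

lemma coset_eq_iff:
  assumes "x \<in> carrier M" "y \<in> carrier M"
  shows "N +>\<^bsub>M\<^esub> x = N +>\<^bsub>M\<^esub> y \<longleftrightarrow> x \<oplus>\<^bsub>M\<^esub> \<ominus>\<^bsub>M\<^esub> y \<in> N"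
  using assms N.a_rcos_module[OF assms(2,1)] N.a_rcos_self N.a_repr_independence' by metis

lemma carrier_quotient: "carrier (quotient_gmodule M N) = (\<lambda>x. N +>\<^bsub>M\<^esub> x) ` carrier M"
  by (auto simp: quotient_gmodule_def A_RCOSETS_def' a_r_coset_def')

lemma coset_in_quotient: "x \<in> carrier M \<Longrightarrow> N +>\<^bsub>M\<^esub> x \<in> carrier (quotient_gmodule M N)"
  by (simp add: carrier_quotient)

lemma add_quotient:
  assumes "x \<in> carrier M" "y \<in> carrier M"
  shows "(N +>\<^bsub>M\<^esub> x) \<oplus>\<^bsub>quotient_gmodule M N\<^esub> (N +>\<^bsub>M\<^esub> y) = N +>\<^bsub>M\<^esub> (x \<oplus>\<^bsub>M\<^esub> y)"
  using N.a_rcos_sum[OF assms] by (simp add: quotient_gmodule_def)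

text \<open>The operations of the quotient are unions over all representatives of a coset. This collapses
  such a union to a single representative.\<close>

lemma UN_coset:
  assumes "x \<in> carrier M"
    and "\<And>y. y \<in> carrier M \<Longrightarrow> y \<oplus>\<^bsub>M\<^esub> \<ominus>\<^bsub>M\<^esub> x \<in> N \<Longrightarrow> f y = f x"
  shows "(\<Union>y\<in>N +>\<^bsub>M\<^esub> x. f y) = f x"
proof -
  have "f y = f x" if "y \<in> N +>\<^bsub>M\<^esub> x" for y
    using that assms N.a_elemrcos_carrier[OF assms(1)] N.a_rcos_module[OF assms(1)] by blast
  then show ?thesis
    using N.a_rcos_self[OF assms(1)] by blast
qed

lemma smult_quotient:
  assumes x: "x \<in> carrier M"
  shows "a \<odot>\<^bsub>quotient_gmodule M N\<^esub> (N +>\<^bsub>M\<^esub> x) = N +>\<^bsub>M\<^esub> (a \<odot>\<^bsub>M\<^esub> x)"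
proof -
  have "N +>\<^bsub>M\<^esub> (a \<odot>\<^bsub>M\<^esub> y) = N +>\<^bsub>M\<^esub> (a \<odot>\<^bsub>M\<^esub> x)"
    if y: "y \<in> carrier M" and "y \<oplus>\<^bsub>M\<^esub> \<ominus>\<^bsub>M\<^esub> x \<in> N" for y
  proof -
    have "a \<odot>\<^bsub>M\<^esub> (y \<oplus>\<^bsub>M\<^esub> \<ominus>\<^bsub>M\<^esub> x) \<in> N"
      using that smult_stable by blast
    then show ?thesis
      using x y by (subst coset_eq_iff) (simp_all add: M.smult_r_distr M.smult_r_minus)
  qed
  then show ?thesis
    using UN_coset[OF x, of "\<lambda>y. N +>\<^bsub>M\<^esub> (a \<odot>\<^bsub>M\<^esub> y)"] by (simp add: quotient_gmodule_def)
qed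

lemma act_zero: "g \<in> carrier G \<Longrightarrow> act M g \<zero>\<^bsub>M\<^esub> = \<zero>\<^bsub>M\<^esub>"
  using act_smult[of g "\<zero>\<^bsub>M\<^esub>" 0] act_closed[of g "\<zero>\<^bsub>M\<^esub>"] M.smult_l_null by simp

lemma act_minus:
  assumes "g \<in> carrier G" "x \<in> carrier M"
  shows "act M g (\<ominus>\<^bsub>M\<^esub> x) = \<ominus>\<^bsub>M\<^esub> act M g x"
proof (rule M.minus_equality[symmetric])
  show "act M g (\<ominus>\<^bsub>M\<^esub> x) \<oplus>\<^bsub>M\<^esub> act M g x = \<zero>\<^bsub>M\<^esub>"
    using assms act_add[of g "\<ominus>\<^bsub>M\<^esub> x" x] by (simp add: M.l_neg act_zero)
qed (use assms act_closed in auto)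

lemma act_quotient:
  assumes g: "g \<in> carrier G" and x: "x \<in> carrier M"
  shows "act (quotient_gmodule M N) g (N +>\<^bsub>M\<^esub> x) = N +>\<^bsub>M\<^esub> act M g x"
proof -
  have "N +>\<^bsub>M\<^esub> act M g y = N +>\<^bsub>M\<^esub> act M g x"
    if y: "y \<in> carrier M" and "y \<oplus>\<^bsub>M\<^esub> \<ominus>\<^bsub>M\<^esub> x \<in> N" for y
  proof -
    have "act M g (y \<oplus>\<^bsub>M\<^esub> \<ominus>\<^bsub>M\<^esub> x) \<in> N"
      using that g act_stable by blast
    then show ?thesis
      using x y g act_closed by (subst coset_eq_iff) (simp_all add: act_add act_minus)
  qed
  then show ?thesis
    using UN_coset[OF x, of "\<lambda>y. N +>\<^bsub>M\<^esub> act M g y"] by (simp add: quotient_gmodule_def)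
qed

lemma abelian_group_quotient: "abelian_group (quotient_gmodule M N)"
proof (rule abelian_groupI)
  have zero: "\<zero>\<^bsub>quotient_gmodule M N\<^esub> = N +>\<^bsub>M\<^esub> \<zero>\<^bsub>M\<^esub>"
    using N.a_rcos_const by (simp add: quotient_gmodule_def)
  then show "\<zero>\<^bsub>quotient_gmodule M N\<^esub> \<in> carrier (quotient_gmodule M N)"
    by (simp add: coset_in_quotient)
  fix X assume "X \<in> carrier (quotient_gmodule M N)"
  then obtain x where x: "x \<in> carrier M" "X = N +>\<^bsub>M\<^esub> x"
    by (auto simp: carrier_quotient)
  then show "\<zero>\<^bsub>quotient_gmodule M N\<^esub> \<oplus>\<^bsub>quotient_gmodule M N\<^esub> X = X"
    by (simp add: zero add_quotient)
  show "\<exists>Y\<in>carrier (quotient_gmodule M N).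
      Y \<oplus>\<^bsub>quotient_gmodule M N\<^esub> X = \<zero>\<^bsub>quotient_gmodule M N\<^esub>"
    using x by (intro bexI[of _ "N +>\<^bsub>M\<^esub> (\<ominus>\<^bsub>M\<^esub> x)"])
      (simp_all add: zero add_quotient coset_in_quotient M.l_neg)
qed (auto simp: carrier_quotient add_quotient M.a_ac)

lemma cg_module_quotient: "cg_module G (quotient_gmodule M N)"
proof (intro cg_module.intro moduleI cg_module_axioms.intro)
  show "group G"
    by (rule G.group_axioms)
qed (auto simp: cring_complex_ring abelian_group_quotient carrier_quotient smult_quotient
    act_quotient add_quotient act_closed act_add act_smult act_one act_mult
    M.smult_l_distr[simplified] M.smult_r_distr M.smult_assoc1[simplified] M.smult_one[simplified])

end

text \<open>This is a model, on the carrier of \<open>M\<close>, of the tensor product of \<open>M\<close> with the one-dimensional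
  representation of character \<open>\<chi>\<close>.\<close>

definition twist_gmodule :: "('g \<Rightarrow> complex) \<Rightarrow> ('g, 'm) gmodule \<Rightarrow> ('g, 'm) gmodule" where
  "twist_gmodule \<chi> M = M\<lparr>act := \<lambda>g x. \<chi> g \<odot>\<^bsub>M\<^esub> act M g x\<rparr>"

lemma twist_gmodule_simps [simp]:
  "carrier (twist_gmodule \<chi> M) = carrier M"
  "x \<oplus>\<^bsub>twist_gmodule \<chi> M\<^esub> y = x \<oplus>\<^bsub>M\<^esub> y"
  "a \<odot>\<^bsub>twist_gmodule \<chi> M\<^esub> x = a \<odot>\<^bsub>M\<^esub> x"
  "act (twist_gmodule \<chi> M) g x = \<chi> g \<odot>\<^bsub>M\<^esub> act M g x"
  by (simp_all add: twist_gmodule_def)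

lemma cg_isomorphism_comp:
  assumes "cg_isomorphism G M N f" "cg_isomorphism G N P h"
  shows "cg_isomorphism G M P (h \<circ> f)"
proof -
  have "f x \<in> carrier N" if "x \<in> carrier M" for x
    using assms(1) that unfolding cg_isomorphism_def by (meson bij_betwE)
  then show ?thesis
    using assms unfolding cg_isomorphism_def by (auto intro: bij_betw_trans)
qed

text \<open>A map of representatives that is linear, and equivariant up to \<open>\<chi>\<close>, induces an isomorphism of the
  quotients as soon as the preimage of \<open>N'\<close> is \<open>N\<close> and the image meets every coset of \<open>N'\<close>.\<close>

lemma quotient_isomorphism:
  assumes MN: "cg_submodule G M N" and MN': "cg_submodule G M' N'"
    and closed: "\<And>x. x \<in> carrier M \<Longrightarrow> F x \<in> carrier M'"
    and add: "\<And>x y. \<lbrakk>x \<in> carrier M; y \<in> carrier M\<rbrakk> \<Longrightarrow> F (x \<oplus>\<^bsub>M\<^esub> y) = F x \<oplus>\<^bsub>M'\<^esub> F y"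
    and smult: "\<And>a x. x \<in> carrier M \<Longrightarrow> F (a \<odot>\<^bsub>M\<^esub> x) = a \<odot>\<^bsub>M'\<^esub> F x"
    and act: "\<And>g x. \<lbrakk>g \<in> carrier G; x \<in> carrier M\<rbrakk> \<Longrightarrow> F (act M g x) = \<chi> g \<odot>\<^bsub>M'\<^esub> act M' g (F x)"
    and kernel: "\<And>x. x \<in> carrier M \<Longrightarrow> F x \<in> N' \<longleftrightarrow> x \<in> N"
    and onto: "\<And>y. y \<in> carrier M' \<Longrightarrow> \<exists>x\<in>carrier M. y \<oplus>\<^bsub>M'\<^esub> \<ominus>\<^bsub>M'\<^esub> F x \<in> N'"
  shows "\<exists>f. cg_isomorphism G (quotient_gmodule M N) (twist_gmodule \<chi> (quotient_gmodule M' N')) f"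
proof -
  interpret M: cg_submodule G M N by (rule MN)
  interpret M': cg_submodule G M' N' by (rule MN')
  define f where "f X = (\<Union>x\<in>X. N' +>\<^bsub>M'\<^esub> F x)" for X
  have minus: "F (\<ominus>\<^bsub>M\<^esub> x) = \<ominus>\<^bsub>M'\<^esub> F x" if "x \<in> carrier M" for x
  proof (rule M'.M.minus_equality[symmetric])
    have "F \<zero>\<^bsub>M\<^esub> = \<zero>\<^bsub>M'\<^esub>"
      using smult[OF that, of 0] M.M.smult_l_null[OF that] M'.M.smult_l_null[OF closed[OF that]]
      by simp
    then show "F (\<ominus>\<^bsub>M\<^esub> x) \<oplus>\<^bsub>M'\<^esub> F x = \<zero>\<^bsub>M'\<^esub>"
      using that add[of "\<ominus>\<^bsub>M\<^esub> x" x] by (simp add: M.M.l_neg)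
  qed (use that closed in auto)
  have same: "N' +>\<^bsub>M'\<^esub> F x = N' +>\<^bsub>M'\<^esub> F y \<longleftrightarrow> N +>\<^bsub>M\<^esub> x = N +>\<^bsub>M\<^esub> y"
    if "x \<in> carrier M" "y \<in> carrier M" for x y
    using that kernel[of "x \<oplus>\<^bsub>M\<^esub> \<ominus>\<^bsub>M\<^esub> y"]
    by (simp add: M.coset_eq_iff M'.coset_eq_iff closed add minus)
  have f: "f (N +>\<^bsub>M\<^esub> x) = N' +>\<^bsub>M'\<^esub> F x" if "x \<in> carrier M" for x
    unfolding f_def using that by (intro M.UN_coset) (simp_all add: same M.coset_eq_iff)
  have "bij_betw f (carrier (quotient_gmodule M N)) (carrier (quotient_gmodule M' N'))"
    unfolding bij_betw_def
  proof
    show "inj_on f (carrier (quotient_gmodule M N))"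
      by (auto simp: inj_on_def M.carrier_quotient f same)
    have "\<exists>x\<in>carrier M. N' +>\<^bsub>M'\<^esub> y = N' +>\<^bsub>M'\<^esub> F x" if "y \<in> carrier M'" for y
      using onto[OF that] that closed M'.coset_eq_iff by metis
    then show "f ` carrier (quotient_gmodule M N) = carrier (quotient_gmodule M' N')"
      using closed by (fastforce simp: M.carrier_quotient M'.carrier_quotient image_image f)
  qed
  then have "cg_isomorphism G (quotient_gmodule M N) (twist_gmodule \<chi> (quotient_gmodule M' N')) f"
    unfolding cg_isomorphism_def
    by (auto simp: M.carrier_quotient f closed add smult act M.act_closed M'.act_closed
        M.add_quotient M'.add_quotient M.smult_quotient M'.smult_quotient
        M.act_quotient M'.act_quotient)
  then show ?thesis
    by blast
qed

section \<open>Tensor products\<close>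

lemma lookup_map_times [simp]:
  "Poly_Mapping.lookup (Poly_Mapping.map ((*) a) u) k = a * Poly_Mapping.lookup u k" for a :: complex
  by (simp add: Poly_Mapping.map.rep_eq when_def)

lemma keys_map_times: "Poly_Mapping.keys (Poly_Mapping.map ((*) a) u) \<subseteq> Poly_Mapping.keys u"
  for a :: complex
  by (auto simp: in_keys_iff)

lemma sum_single_lookup:
  assumes "finite S" "Poly_Mapping.keys u \<subseteq> S"
  shows "(\<Sum>k\<in>S. Poly_Mapping.single k (Poly_Mapping.lookup u k)) = u"
proof (rule poly_mapping_eqI)
  fix k
  have "k \<notin> S \<Longrightarrow> Poly_Mapping.lookup u k = 0"
    using assms(2) by (auto simp: in_keys_iff)
  then show "Poly_Mapping.lookup (\<Sum>k\<in>S. Poly_Mapping.single k (Poly_Mapping.lookup u k)) k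
      = Poly_Mapping.lookup u k"
    using assms(1) by (simp add: lookup_sum lookup_single when_def)
qed

text \<open>The linear map of free vector spaces that extends a map of the bases. The action on
  \<^const>\<open>free_gmodule_times\<close> has this form.\<close>

definition push_forward :: "('a \<Rightarrow> 'b) \<Rightarrow> ('a \<Rightarrow>\<^sub>0 complex) \<Rightarrow> ('b \<Rightarrow>\<^sub>0 complex)" where
  "push_forward f u =
    (\<Sum>k\<in>Poly_Mapping.keys u. Poly_Mapping.single (f k) (Poly_Mapping.lookup u k))"

lemma push_forward_superset:
  assumes "finite S" "Poly_Mapping.keys u \<subseteq> S"
  shows "push_forward f u = (\<Sum>k\<in>S. Poly_Mapping.single (f k) (Poly_Mapping.lookup u k))"
  unfolding push_forward_def using assms by (intro sum.mono_neutral_left) (auto simp: in_keys_iff)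

lemma push_forward_zero [simp]: "push_forward f 0 = 0"
  by (simp add: push_forward_def)

lemma push_forward_single [simp]:
  "push_forward f (Poly_Mapping.single k a) = Poly_Mapping.single (f k) a"
  by (simp add: push_forward_def)

lemma push_forward_add: "push_forward f (u + v) = push_forward f u + push_forward f v"
proof -
  let ?S = "Poly_Mapping.keys u \<union> Poly_Mapping.keys v"
  show ?thesis
    using keys_add[of u v]
    by (simp add: push_forward_superset[of ?S] lookup_add single_add sum.distrib)
qed

lemma push_forward_minus: "push_forward f (- u) = - push_forward f u"
  using push_forward_add[of f u "- u"] by (simp add: eq_neg_iff_add_eq_0 add.commute)

lemma push_forward_diff: "push_forward f (u - v) = push_forward f u - push_forward f v"
  using push_forward_add[of f u "- v"] by (simp add: push_forward_minus)

lemma push_forward_sum: "push_forward f (\<Sum>k\<in>S. u k) = (\<Sum>k\<in>S. push_forward f (u k))"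
  by (induction S rule: infinite_finite_induct) (simp_all add: push_forward_add)

lemma push_forward_times:
  "push_forward f (Poly_Mapping.map ((*) a) u) = Poly_Mapping.map ((*) a) (push_forward f u)"
proof (rule poly_mapping_eqI)
  fix k
  show "Poly_Mapping.lookup (push_forward f (Poly_Mapping.map ((*) a) u)) k
    = Poly_Mapping.lookup (Poly_Mapping.map ((*) a) (push_forward f u)) k"
    using keys_map_times[of a u]
    by (simp add: push_forward_superset[of "Poly_Mapping.keys u"] lookup_sum lookup_single when_def
        sum_distrib_left if_distrib cong: if_cong)
qed

lemma keys_push_forward: "Poly_Mapping.keys (push_forward f u) \<subseteq> f ` Poly_Mapping.keys u"
proof
  fix k assume "k \<in> Poly_Mapping.keys (push_forward f u)"
  then have "(\<Sum>l\<in>Poly_Mapping.keys u.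
      Poly_Mapping.lookup (Poly_Mapping.single (f l) (Poly_Mapping.lookup u l)) k) \<noteq> 0"
    by (simp add: push_forward_def in_keys_iff lookup_sum)
  then obtain l where "l \<in> Poly_Mapping.keys u"
      "Poly_Mapping.lookup (Poly_Mapping.single (f l) (Poly_Mapping.lookup u l)) k \<noteq> 0"
    by (rule sum.not_neutral_contains_not_neutral)
  then show "k \<in> f ` Poly_Mapping.keys u"
    by (auto simp: lookup_single when_def split: if_splits)
qed

lemma push_forward_push_forward: "push_forward f (push_forward h u) = push_forward (f \<circ> h) u"
  unfolding push_forward_def[of h u] push_forward_def[of "f \<circ> h" u] by (simp add: push_forward_sum)

lemma push_forward_cong:
  "(\<And>k. k \<in> Poly_Mapping.keys u \<Longrightarrow> f k = h k) \<Longrightarrow> push_forward f u = push_forward h u"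
  by (simp add: push_forward_def)

lemma push_forward_ident:
  "(\<And>k. k \<in> Poly_Mapping.keys u \<Longrightarrow> f k = k) \<Longrightarrow> push_forward f u = u"
  using sum_single_lookup[of "Poly_Mapping.keys u" u] by (simp add: push_forward_def)

lemma free_gmodule_times_simps [simp]:
  "carrier (free_gmodule_times M N) = {u. Poly_Mapping.keys u \<subseteq> carrier M \<times> carrier N}"
  "\<zero>\<^bsub>free_gmodule_times M N\<^esub> = 0"
  "u \<oplus>\<^bsub>free_gmodule_times M N\<^esub> v = u + v"
  "a \<odot>\<^bsub>free_gmodule_times M N\<^esub> u = Poly_Mapping.map ((*) a) u"
  "act (free_gmodule_times M N) g u = push_forward (map_prod (act M g) (act N g)) u"
  by (simp_all add: free_gmodule_times_def push_forward_def case_prod_unfold map_prod_def)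

lemma abelian_group_free: "abelian_group (free_gmodule_times M N)"
proof (rule abelian_groupI)
  fix u assume "u \<in> carrier (free_gmodule_times M N)"
  then show "\<exists>v\<in>carrier (free_gmodule_times M N).
      v \<oplus>\<^bsub>free_gmodule_times M N\<^esub> u = \<zero>\<^bsub>free_gmodule_times M N\<^esub>"
    by (intro bexI[of _ "- u"]) auto
qed (use keys_add in \<open>fastforce simp: add.assoc add.commute\<close>)+

lemma cg_module_free:
  assumes "cg_module G M" "cg_module G N"
  shows "cg_module G (free_gmodule_times M N)"
proof -
  interpret M: cg_module G M by (rule assms(1))
  interpret N: cg_module G N by (rule assms(2))
  show ?thesis
  proof (intro cg_module.intro moduleI cg_module_axioms.intro)
    show "group G"
      by (rule M.G.group_axioms)
    fix a b :: complex and g h u v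
    show "cring complex_ring" "abelian_group (free_gmodule_times M N)"
      by (rule cring_complex_ring abelian_group_free)+
    let ?F = "free_gmodule_times M N"
    assume u: "u \<in> carrier ?F"
    show "a \<odot>\<^bsub>?F\<^esub> u \<in> carrier ?F"
      using u keys_map_times[of a u] by auto
    show "(a \<oplus>\<^bsub>complex_ring\<^esub> b) \<odot>\<^bsub>?F\<^esub> u = a \<odot>\<^bsub>?F\<^esub> u \<oplus>\<^bsub>?F\<^esub> b \<odot>\<^bsub>?F\<^esub> u"
      by (rule poly_mapping_eqI) (simp add: lookup_add distrib_right)
    show "(a \<otimes>\<^bsub>complex_ring\<^esub> b) \<odot>\<^bsub>?F\<^esub> u = a \<odot>\<^bsub>?F\<^esub> (b \<odot>\<^bsub>?F\<^esub> u)"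
      by (rule poly_mapping_eqI) simp
    show "\<one>\<^bsub>complex_ring\<^esub> \<odot>\<^bsub>?F\<^esub> u = u"
      by (rule poly_mapping_eqI) simp
    show "a \<odot>\<^bsub>?F\<^esub> (u \<oplus>\<^bsub>?F\<^esub> v) = a \<odot>\<^bsub>?F\<^esub> u \<oplus>\<^bsub>?F\<^esub> a \<odot>\<^bsub>?F\<^esub> v"
      by (rule poly_mapping_eqI) (simp add: lookup_add distrib_left)
    show "act ?F \<one>\<^bsub>G\<^esub> u = u"
      using u by (auto intro!: push_forward_ident simp: M.act_one N.act_one)
    assume g: "g \<in> carrier G"
    show "act ?F g u \<in> carrier ?F"
      using u g keys_push_forward[of "map_prod (act M g) (act N g)" u]
      by (fastforce simp: M.act_closed N.act_closed)
    show "act ?F g (u \<oplus>\<^bsub>?F\<^esub> v) = act ?F g u \<oplus>\<^bsub>?F\<^esub> act ?F g v"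
      by (simp add: push_forward_add)
    show "act ?F g (a \<odot>\<^bsub>?F\<^esub> u) = a \<odot>\<^bsub>?F\<^esub> act ?F g u"
      by (simp add: push_forward_times)
    assume h: "h \<in> carrier G"
    show "act ?F (g \<otimes>\<^bsub>G\<^esub> h) u = act ?F g (act ?F h u)"
      using u g h
      by (auto intro!: push_forward_cong simp: push_forward_push_forward M.act_mult N.act_mult)
  qed
qed

definition bilinear_span ::
    "('g, 'm) gmodule \<Rightarrow> ('g, 'n) gmodule \<Rightarrow> (('m \<times> 'n) \<Rightarrow>\<^sub>0 complex) set" where
  "bilinear_span M N =
    \<Inter>{U. submodule U complex_ring (free_gmodule_times M N) \<and> bilinear_relations M N \<subseteq> U}"

lemma tensor_gmodule_eq:
  "tensor_gmodule M N = quotient_gmodule (free_gmodule_times M N) (bilinear_span M N)"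
  by (simp add: tensor_gmodule_def bilinear_span_def Let_def)

lemma bilinear_relations_in_span: "bilinear_relations M N \<subseteq> bilinear_span M N"
  by (auto simp: bilinear_span_def)

lemma bilinear_span_least:
  "submodule U complex_ring (free_gmodule_times M N) \<Longrightarrow> bilinear_relations M N \<subseteq> U \<Longrightarrow>
    bilinear_span M N \<subseteq> U"
  by (auto simp: bilinear_span_def)

lemma bilinear_relations_cases [consumes 1, case_names add_left add_right smult_left smult_right]:
  assumes "r \<in> bilinear_relations M N"
  obtains x x' y where "x \<in> carrier M" "x' \<in> carrier M" "y \<in> carrier N"
      "r = pair_generator (x \<oplus>\<^bsub>M\<^esub> x') y - pair_generator x y - pair_generator x' y"
  | x y y' where "x \<in> carrier M" "y \<in> carrier N" "y' \<in> carrier N"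
      "r = pair_generator x (y \<oplus>\<^bsub>N\<^esub> y') - pair_generator x y - pair_generator x y'"
  | a x y where "x \<in> carrier M" "y \<in> carrier N"
      "r = pair_generator (a \<odot>\<^bsub>M\<^esub> x) y - Poly_Mapping.single (x, y) a"
  | a x y where "x \<in> carrier M" "y \<in> carrier N"
      "r = pair_generator x (a \<odot>\<^bsub>N\<^esub> y) - Poly_Mapping.single (x, y) a"
  using assms unfolding bilinear_relations_def by blast

lemma bilinear_relationsI:
  "\<lbrakk>x \<in> carrier M; x' \<in> carrier M; y \<in> carrier N\<rbrakk> \<Longrightarrow>
    pair_generator (x \<oplus>\<^bsub>M\<^esub> x') y - pair_generator x y - pair_generator x' y \<in> bilinear_relations M N"
  "\<lbrakk>x \<in> carrier M; y \<in> carrier N; y' \<in> carrier N\<rbrakk> \<Longrightarrow>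
    pair_generator x (y \<oplus>\<^bsub>N\<^esub> y') - pair_generator x y - pair_generator x y' \<in> bilinear_relations M N"
  "\<lbrakk>x \<in> carrier M; y \<in> carrier N\<rbrakk> \<Longrightarrow>
    pair_generator (a \<odot>\<^bsub>M\<^esub> x) y - Poly_Mapping.single (x, y) a \<in> bilinear_relations M N"
  "\<lbrakk>x \<in> carrier M; y \<in> carrier N\<rbrakk> \<Longrightarrow>
    pair_generator x (a \<odot>\<^bsub>N\<^esub> y) - Poly_Mapping.single (x, y) a \<in> bilinear_relations M N"
  unfolding bilinear_relations_def by blast+

lemma a_inv_free:
  assumes "u \<in> carrier (free_gmodule_times M N)"
  shows "\<ominus>\<^bsub>free_gmodule_times M N\<^esub> u = - u"
  using assms by (intro abelian_group.minus_equality[OF abelian_group_free]) auto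

lemma submodule_freeI:
  assumes "cg_module G M" "cg_module G N"
    and "\<And>u. u \<in> U \<Longrightarrow> Poly_Mapping.keys u \<subseteq> carrier M \<times> carrier N"
    and "0 \<in> U" "\<And>u. u \<in> U \<Longrightarrow> - u \<in> U" "\<And>u v. \<lbrakk>u \<in> U; v \<in> U\<rbrakk> \<Longrightarrow> u + v \<in> U"
    and "\<And>a u. u \<in> U \<Longrightarrow> Poly_Mapping.map ((*) a) u \<in> U"
  shows "submodule U complex_ring (free_gmodule_times M N)"
proof -
  interpret F: cg_module G "free_gmodule_times M N"
    by (rule cg_module_free[OF assms(1,2)])
  show ?thesis
  proof (rule F.M.submoduleI)
    show "\<ominus>\<^bsub>free_gmodule_times M N\<^esub> u \<in> U" if "u \<in> U" for u
      using that assms(3,5) by (simp add: a_inv_free)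
  qed (use assms in auto)
qed

lemma submodule_freeE:
  assumes "cg_module G M" "cg_module G N" "submodule U complex_ring (free_gmodule_times M N)"
  shows "u \<in> U \<Longrightarrow> Poly_Mapping.keys u \<subseteq> carrier M \<times> carrier N"
    and "0 \<in> U" and "u \<in> U \<Longrightarrow> - u \<in> U" and "\<lbrakk>u \<in> U; v \<in> U\<rbrakk> \<Longrightarrow> u + v \<in> U"
    and "u \<in> U \<Longrightarrow> Poly_Mapping.map ((*) a) u \<in> U"
proof -
  interpret F: cg_module G "free_gmodule_times M N"
    by (rule cg_module_free[OF assms(1,2)])
  note E = F.M.submoduleE[OF assms(3)]
  show keys: "u \<in> U \<Longrightarrow> Poly_Mapping.keys u \<subseteq> carrier M \<times> carrier N" for u
    using E(1) by auto
  show minus: "u \<in> U \<Longrightarrow> - u \<in> U" for u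
    using E(3)[of u] keys[of u] by (simp add: a_inv_free)
  show plus: "\<lbrakk>u \<in> U; v \<in> U\<rbrakk> \<Longrightarrow> u + v \<in> U" for u v
    using E(5)[of u v] by simp
  show "u \<in> U \<Longrightarrow> Poly_Mapping.map ((*) a) u \<in> U"
    using E(4)[of a u] by simp
  show "0 \<in> U"
    using E(2) minus plus by fastforce
qed

lemma submodule_bilinear_span:
  assumes "cg_module G M" "cg_module G N"
  shows "submodule (bilinear_span M N) complex_ring (free_gmodule_times M N)"
proof -
  interpret M: cg_module G M by (rule assms(1))
  interpret N: cg_module G N by (rule assms(2))
  interpret F: cg_module G "free_gmodule_times M N" by (rule cg_module_free[OF assms])
  have "bilinear_relations M N \<subseteq> carrier (free_gmodule_times M N)"
  proof
    fix r assume "r \<in> bilinear_relations M N"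
    then show "r \<in> carrier (free_gmodule_times M N)"
      by (cases rule: bilinear_relations_cases)
        (auto dest!: keys_diff[THEN subsetD] split: if_splits simp: M.M.smult_closed[simplified]
          N.M.smult_closed[simplified])
  qed
  then have sub: "bilinear_span M N \<subseteq> carrier (free_gmodule_times M N)"
    using bilinear_span_least[OF F.M.carrier_is_submodule] by blast
  show ?thesis
    by (rule submodule_freeI[OF assms])
      (use sub in \<open>auto simp: bilinear_span_def intro: submodule_freeE[OF assms]\<close>)
qed

text \<open>A group element maps each bilinearity relation to another one. Hence the elements whose image
  lies in the span form a submodule that contains all relations.\<close>

lemma cg_submodule_bilinear_span:
  assumes "cg_module G M" "cg_module G N"
  shows "cg_submodule G (free_gmodule_times M N) (bilinear_span M N)"
proof (intro cg_submodule.intro cg_submodule_axioms.intro cg_module_free[OF assms]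
    submodule_bilinear_span[OF assms])
  interpret M: cg_module G M by (rule assms(1))
  interpret N: cg_module G N by (rule assms(2))
  interpret F: cg_module G "free_gmodule_times M N" by (rule cg_module_free[OF assms])
  let ?F = "free_gmodule_times M N" and ?W = "bilinear_span M N"
  note W = submodule_freeE[OF assms submodule_bilinear_span[OF assms]]
  fix g u assume g: "g \<in> carrier G" and u: "u \<in> ?W"
  \<comment> \<open>The preimage of the span under \<open>g\<close>, as a candidate in the intersection that defines the span.\<close>
  let ?U = "{u \<in> ?W. act ?F g u \<in> ?W}"
  have "submodule ?U complex_ring ?F"
    by (rule submodule_freeI[OF assms])
      (use W in \<open>auto simp: push_forward_add push_forward_minus push_forward_times\<close>)
  moreover have "act ?F g r \<in> bilinear_relations M N" if "r \<in> bilinear_relations M N" for r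
    using that
  proof (cases rule: bilinear_relations_cases)
    case (add_left x x' y)
    then show ?thesis
      using bilinear_relationsI(1)[of "act M g x" M "act M g x'" "act N g y" N] g
      by (simp add: push_forward_diff M.act_add M.act_closed N.act_closed)
  next
    case (add_right x y y')
    then show ?thesis
      using bilinear_relationsI(2)[of "act M g x" M "act N g y" N "act N g y'"] g
      by (simp add: push_forward_diff N.act_add M.act_closed N.act_closed)
  next
    case (smult_left a x y)
    then show ?thesis
      using bilinear_relationsI(3)[of "act M g x" M "act N g y" N a] g
      by (simp add: push_forward_diff M.act_smult M.act_closed N.act_closed)
  next
    case (smult_right a x y)
    then show ?thesis
      using bilinear_relationsI(4)[of "act M g x" M "act N g y" N a] g
      by (simp add: push_forward_diff N.act_smult M.act_closed N.act_closed)
  qed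
  then have "bilinear_relations M N \<subseteq> ?U"
    using bilinear_relations_in_span by blast
  ultimately show "act ?F g u \<in> ?W"
    using bilinear_span_least u by blast
qed

lemma cg_module_tensor:
  assumes "cg_module G M" "cg_module G N"
  shows "cg_module G (tensor_gmodule M N)"
  unfolding tensor_gmodule_eq
  by (rule cg_submodule.cg_module_quotient[OF cg_submodule_bilinear_span[OF assms]])

section \<open>Tensoring with the sign representation\<close>

lemma sgn_gmodule_simps [simp]:
  "carrier sgn_gmodule = UNIV" "\<zero>\<^bsub>sgn_gmodule\<^esub> = 0" "x \<oplus>\<^bsub>sgn_gmodule\<^esub> y = x + y"
  "a \<odot>\<^bsub>sgn_gmodule\<^esub> x = a * x" "act sgn_gmodule g z = of_int (sign g) * z"
  by (simp_all add: sgn_gmodule_def)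

lemma cg_module_sgn:
  assumes G: "subgroup G (symmetric_group V)" and grp: "group (symmetric_group V)" and V: "finite V"
  shows "cg_module ((symmetric_group V)\<lparr>carrier := G\<rparr>) sgn_gmodule"
proof (intro cg_module.intro moduleI cg_module_axioms.intro)
  show "group ((symmetric_group V)\<lparr>carrier := G\<rparr>)"
    by (rule subgroup.subgroup_is_group[OF G grp])
  show "abelian_group sgn_gmodule"
  proof (rule abelian_groupI)
    fix x :: complex
    show "\<exists>y\<in>carrier sgn_gmodule. y \<oplus>\<^bsub>sgn_gmodule\<^esub> x = \<zero>\<^bsub>sgn_gmodule\<^esub>"
      by (intro bexI[of _ "- x"]) simp_all
  qed simp_all
  fix g h z
  assume "g \<in> carrier ((symmetric_group V)\<lparr>carrier := G\<rparr>)" "h \<in> carrier ((symmetric_group V)\<lparr>carrier := G\<rparr>)"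
  then have "g permutes V" "h permutes V"
    using subgroup.subset[OF G] by (auto simp: symmetric_group_def)
  then have "permutation g" "permutation h"
    using V permutation_permutes by blast+
  then show "act sgn_gmodule (g \<otimes>\<^bsub>(symmetric_group V)\<lparr>carrier := G\<rparr>\<^esub> h) z
      = act sgn_gmodule g (act sgn_gmodule h z)"
    by (simp add: symmetric_group_def sign_compose)
qed (simp_all add: cring_complex_ring distrib_left distrib_right symmetric_group_def)

context cg_module
begin

text \<open>The linear map with \<open>(x, z) \<mapsto> z x\<close>. It is a left inverse of \<open>x \<mapsto> x \<otimes> 1\<close>, and it kills the bilinearity
  relations. So it detects that \<open>x \<otimes> 1\<close> is zero only for \<open>x = 0\<close>.\<close>

definition eval_tensor :: "('m \<times> complex \<Rightarrow>\<^sub>0 complex) \<Rightarrow> 'm" where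
  "eval_tensor u = (\<Oplus>\<^bsub>M\<^esub>k\<in>Poly_Mapping.keys u. (Poly_Mapping.lookup u k * snd k) \<odot>\<^bsub>M\<^esub> fst k)"

lemma smult_in_carrier [simp]: "x \<in> carrier M \<Longrightarrow> a \<odot>\<^bsub>M\<^esub> x \<in> carrier M"
  using M.smult_closed[of a x] by simp

lemma eval_tensor_superset:
  assumes "finite S" "Poly_Mapping.keys u \<subseteq> S" "S \<subseteq> carrier M \<times> UNIV"
  shows "eval_tensor u = (\<Oplus>\<^bsub>M\<^esub>k\<in>S. (Poly_Mapping.lookup u k * snd k) \<odot>\<^bsub>M\<^esub> fst k)"
  unfolding eval_tensor_def using assms M.smult_l_null
  by (intro M.add.finprod_mono_neutral_cong_left) (auto simp: in_keys_iff)

lemma eval_tensor_closed: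
  "Poly_Mapping.keys u \<subseteq> carrier M \<times> UNIV \<Longrightarrow> eval_tensor u \<in> carrier M"
  unfolding eval_tensor_def by (intro M.finsum_closed) auto

lemma eval_tensor_zero [simp]: "eval_tensor 0 = \<zero>\<^bsub>M\<^esub>"
  by (simp add: eval_tensor_def)

lemma eval_tensor_add:
  assumes "Poly_Mapping.keys u \<subseteq> carrier M \<times> UNIV" "Poly_Mapping.keys v \<subseteq> carrier M \<times> UNIV"
  shows "eval_tensor (u + v) = eval_tensor u \<oplus>\<^bsub>M\<^esub> eval_tensor v"
proof -
  let ?S = "Poly_Mapping.keys u \<union> Poly_Mapping.keys v"
  let ?e = "\<lambda>u k. (Poly_Mapping.lookup u k * snd k) \<odot>\<^bsub>M\<^esub> fst k"
  have S: "finite ?S" "?S \<subseteq> carrier M \<times> UNIV"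
    using assms by auto
  have "eval_tensor (u + v) = (\<Oplus>\<^bsub>M\<^esub>k\<in>?S. ?e (u + v) k)"
    using keys_add by (intro eval_tensor_superset S)
  also have "\<dots> = (\<Oplus>\<^bsub>M\<^esub>k\<in>?S. ?e u k \<oplus>\<^bsub>M\<^esub> ?e v k)"
    using S M.smult_l_distr
    by (intro M.finsum_cong' refl) (auto simp: lookup_add distrib_right)
  also have "\<dots> = eval_tensor u \<oplus>\<^bsub>M\<^esub> eval_tensor v"
    using S by (subst M.finsum_addf) (auto simp: eval_tensor_superset[of ?S])
  finally show ?thesis .
qed

lemma eval_tensor_times:
  assumes "Poly_Mapping.keys u \<subseteq> carrier M \<times> UNIV"
  shows "eval_tensor (Poly_Mapping.map ((*) a) u) = a \<odot>\<^bsub>M\<^esub> eval_tensor u"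
proof -
  let ?S = "Poly_Mapping.keys u"
  have "eval_tensor (Poly_Mapping.map ((*) a) u)
      = (\<Oplus>\<^bsub>M\<^esub>k\<in>?S. a \<odot>\<^bsub>M\<^esub> ((Poly_Mapping.lookup u k * snd k) \<odot>\<^bsub>M\<^esub> fst k))"
    using assms keys_map_times[of a u] M.smult_assoc1
    by (subst eval_tensor_superset[of ?S]) (auto intro!: M.finsum_cong' simp: mult.assoc)
  then show ?thesis
    using assms unfolding eval_tensor_def
    by (subst M.finsum_smult_ldistr) auto
qed

lemma eval_tensor_minus:
  assumes "Poly_Mapping.keys u \<subseteq> carrier M \<times> UNIV"
  shows "eval_tensor (- u) = \<ominus>\<^bsub>M\<^esub> eval_tensor u"
proof (rule M.minus_equality[symmetric])
  show "eval_tensor (- u) \<oplus>\<^bsub>M\<^esub> eval_tensor u = \<zero>\<^bsub>M\<^esub>"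
    using eval_tensor_add[of "- u" u] assms by simp
qed (use assms eval_tensor_closed in auto)

lemma eval_tensor_diff:
  assumes "Poly_Mapping.keys u \<subseteq> carrier M \<times> UNIV" "Poly_Mapping.keys v \<subseteq> carrier M \<times> UNIV"
  shows "eval_tensor (u - v) = eval_tensor u \<oplus>\<^bsub>M\<^esub> \<ominus>\<^bsub>M\<^esub> eval_tensor v"
  using eval_tensor_add[of u "- v"] assms by (simp add: eval_tensor_minus)

lemma eval_tensor_single:
  "x \<in> carrier M \<Longrightarrow> eval_tensor (Poly_Mapping.single (x, z) a) = (a * z) \<odot>\<^bsub>M\<^esub> x"
  using eval_tensor_superset[of "{(x, z)}" "Poly_Mapping.single (x, z) a"] by simp

end

lemma bilinear_span_eval_tensor:
  fixes G :: "('a \<Rightarrow> 'a, 'x) monoid_scheme" and M :: "('a \<Rightarrow> 'a, 'm) gmodule"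
  assumes M: "cg_module G M" and sgn: "cg_module G sgn_gmodule"
    and u: "u \<in> bilinear_span M sgn_gmodule"
  shows "cg_module.eval_tensor M u = \<zero>\<^bsub>M\<^esub>"
proof -
  interpret M: cg_module G M by (rule M)
  have cancel: "(x \<oplus>\<^bsub>M\<^esub> y) \<oplus>\<^bsub>M\<^esub> \<ominus>\<^bsub>M\<^esub> x \<oplus>\<^bsub>M\<^esub> \<ominus>\<^bsub>M\<^esub> y = \<zero>\<^bsub>M\<^esub>"
    if "x \<in> carrier M" "y \<in> carrier M" for x y
    using that M.M.r_neg[of "x \<oplus>\<^bsub>M\<^esub> y"] by (simp add: M.M.minus_add M.M.a_assoc)
  let ?U = "{u. Poly_Mapping.keys u \<subseteq> carrier M \<times> UNIV \<and> M.eval_tensor u = \<zero>\<^bsub>M\<^esub>}"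
  have keys_sub: "Poly_Mapping.keys (u - v) \<subseteq> carrier M \<times> UNIV"
    if "Poly_Mapping.keys u \<subseteq> carrier M \<times> UNIV" "Poly_Mapping.keys v \<subseteq> carrier M \<times> UNIV"
    for u v :: "('m \<times> complex) \<Rightarrow>\<^sub>0 complex"
    using that keys_diff[of u v] by blast
  have "submodule ?U complex_ring (free_gmodule_times M sgn_gmodule)"
  proof (rule submodule_freeI[OF M sgn])
    fix u v and a :: complex assume u: "u \<in> ?U"
    show "- u \<in> ?U"
      using u by (auto simp: M.eval_tensor_minus)
    show "Poly_Mapping.map ((*) a) u \<in> ?U"
      using u keys_map_times[of a u] M.M.smult_r_null[of a] by (auto simp: M.eval_tensor_times)
    assume v: "v \<in> ?U"
    show "u + v \<in> ?U"
      using u v keys_add[of u v] by (auto simp: M.eval_tensor_add)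
  qed auto
  moreover have "bilinear_relations M sgn_gmodule \<subseteq> ?U"
  proof
    fix r assume "r \<in> bilinear_relations M sgn_gmodule"
    then show "r \<in> ?U"
    proof (cases rule: bilinear_relations_cases)
      case (add_left x x' y)
      then show ?thesis
        using cancel M.M.smult_r_distr
        by (simp add: keys_sub M.eval_tensor_diff M.eval_tensor_single)
    next
      case (add_right x y y')
      then show ?thesis
        using cancel M.M.smult_l_distr
        by (simp add: keys_sub M.eval_tensor_diff M.eval_tensor_single)
    next
      case (smult_left a x y)
      then show ?thesis
        using M.M.smult_assoc1[of y a x]
        by (simp add: keys_sub M.eval_tensor_diff M.eval_tensor_single M.M.r_neg mult.commute)
    next
      case (smult_right a x y)
      then show ?thesis
        by (simp add: keys_sub M.eval_tensor_diff M.eval_tensor_single M.M.r_neg)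
    qed
  qed
  ultimately show ?thesis
    using bilinear_span_least u by blast
qed

text \<open>The isomorphism is \<open>x \<mapsto> x \<otimes> 1\<close>. It is onto because \<open>x \<otimes> z = z x \<otimes> 1\<close>, and injective by
  \<open>eval_tensor\<close>.\<close>

lemma tensor_sgn_isomorphism:
  fixes G :: "('a \<Rightarrow> 'a, 'x) monoid_scheme"
  assumes M: "cg_module G M" and sgn: "cg_module G sgn_gmodule"
  shows "\<exists>f. cg_isomorphism G (twist_gmodule (\<lambda>g. of_int (sign g)) M) (tensor_gmodule M sgn_gmodule) f"
proof -
  let ?F = "free_gmodule_times M sgn_gmodule" and ?W = "bilinear_span M sgn_gmodule"
  interpret M: cg_module G M by (rule M)
  interpret W: cg_submodule G ?F ?W
    by (rule cg_submodule_bilinear_span[OF M sgn])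
  note Wsub = submodule_freeE[OF M sgn submodule_bilinear_span[OF M sgn]]
  have rel_add: "pair_generator (x \<oplus>\<^bsub>M\<^esub> y) z - pair_generator x z - pair_generator y z \<in> ?W"
    if "x \<in> carrier M" "y \<in> carrier M" for x y z
    using that bilinear_relationsI(1)[of x M y z sgn_gmodule] bilinear_relations_in_span by auto
  have rel_left: "pair_generator (a \<odot>\<^bsub>M\<^esub> x) z - Poly_Mapping.single (x, z) a \<in> ?W"
    if "x \<in> carrier M" for a x z
    using that bilinear_relationsI(3)[of x M z sgn_gmodule a] bilinear_relations_in_span by auto
  have rel_right: "pair_generator x (a * z) - Poly_Mapping.single (x, z) a \<in> ?W"
    if "x \<in> carrier M" for a x z
    using that bilinear_relationsI(4)[of x M z sgn_gmodule a] bilinear_relations_in_span by auto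
  define j where "j x = ?W +>\<^bsub>?F\<^esub> pair_generator x 1" for x
  have coset_eq: "?W +>\<^bsub>?F\<^esub> u = ?W +>\<^bsub>?F\<^esub> v" if "u - v \<in> ?W" "u \<in> carrier ?F" "v \<in> carrier ?F" for u v
    using that by (subst W.coset_eq_iff) (simp_all add: a_inv_free)
  have single: "?W +>\<^bsub>?F\<^esub> Poly_Mapping.single (x, z) a = j ((a * z) \<odot>\<^bsub>M\<^esub> x)" if x: "x \<in> carrier M" for x z a
  proof -
    have "?W +>\<^bsub>?F\<^esub> pair_generator x (a * z) = ?W +>\<^bsub>?F\<^esub> Poly_Mapping.single (x, z) a"
      using x by (intro coset_eq rel_right) auto
    moreover have "?W +>\<^bsub>?F\<^esub> pair_generator x (a * z) = ?W +>\<^bsub>?F\<^esub> Poly_Mapping.single (x, 1) (a * z)"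
      using x rel_right[OF x, of "a * z" 1] by (intro coset_eq) auto
    moreover have "j ((a * z) \<odot>\<^bsub>M\<^esub> x) = ?W +>\<^bsub>?F\<^esub> Poly_Mapping.single (x, 1) (a * z)"
      unfolding j_def using x by (intro coset_eq rel_left) auto
    ultimately show ?thesis
      by simp
  qed
  have j_closed: "j x \<in> carrier (tensor_gmodule M sgn_gmodule)" if "x \<in> carrier M" for x
    unfolding j_def tensor_gmodule_eq using that by (intro W.coset_in_quotient) simp
  have j_add: "j (x \<oplus>\<^bsub>M\<^esub> y) = j x \<oplus>\<^bsub>tensor_gmodule M sgn_gmodule\<^esub> j y"
    if "x \<in> carrier M" "y \<in> carrier M" for x y
  proof -
    have "pair_generator (x \<oplus>\<^bsub>M\<^esub> y) 1 - (pair_generator x 1 + pair_generator y 1) \<in> ?W"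
      using rel_add[OF that, of 1] by (simp add: diff_diff_add)
    then have "j (x \<oplus>\<^bsub>M\<^esub> y) = ?W +>\<^bsub>?F\<^esub> (pair_generator x 1 + pair_generator y 1)"
      unfolding j_def using that keys_add[of "pair_generator x 1" "pair_generator y (1::complex)"]
      by (intro coset_eq) auto
    also have "\<dots> = j x \<oplus>\<^bsub>tensor_gmodule M sgn_gmodule\<^esub> j y"
      unfolding j_def tensor_gmodule_eq using that by (subst W.add_quotient) auto
    finally show ?thesis .
  qed
  have j_smult: "j (a \<odot>\<^bsub>M\<^esub> x) = a \<odot>\<^bsub>tensor_gmodule M sgn_gmodule\<^esub> j x" if "x \<in> carrier M" for a x
  proof -
    have "Poly_Mapping.map ((*) a) (pair_generator x (1 :: complex)) = Poly_Mapping.single (x, 1) a"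
      by (rule poly_mapping_eqI) (simp add: lookup_single when_def)
    then show ?thesis
      unfolding tensor_gmodule_eq using that single[of x 1 a] W.smult_quotient[of "pair_generator x 1" a]
      by (simp add: j_def)
  qed
  have j_act: "j (of_int (sign g) \<odot>\<^bsub>M\<^esub> act M g x) = act (tensor_gmodule M sgn_gmodule) g (j x)"
    if "g \<in> carrier G" "x \<in> carrier M" for g x
    unfolding tensor_gmodule_eq
    using that single[of "act M g x" "of_int (sign g)" 1] W.act_quotient[of g "pair_generator x 1"]
    by (simp add: j_def M.act_closed)
  have "inj_on j (carrier M)"
  proof (rule inj_onI)
    fix x y assume x: "x \<in> carrier M" and y: "y \<in> carrier M" and "j x = j y"
    then have "pair_generator x 1 - pair_generator y 1 \<in> ?W"
      unfolding j_def by (subst (asm) W.coset_eq_iff) (simp_all add: a_inv_free)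
    then have "M.eval_tensor (pair_generator x 1 - pair_generator y 1) = \<zero>\<^bsub>M\<^esub>"
      by (rule bilinear_span_eval_tensor[OF M sgn])
    then have "x \<oplus>\<^bsub>M\<^esub> \<ominus>\<^bsub>M\<^esub> y = \<zero>\<^bsub>M\<^esub>"
      using x y M.M.smult_one by (simp add: M.eval_tensor_diff M.eval_tensor_single)
    then show "x = y"
      using x y by (metis M.M.minus_equality M.M.minus_minus M.M.a_inv_closed)
  qed
  moreover have "j ` carrier M = carrier (tensor_gmodule M sgn_gmodule)"
  proof
    have "\<exists>x\<in>carrier M. ?W +>\<^bsub>?F\<^esub> (\<Sum>k\<in>S. Poly_Mapping.single k (c k)) = j x"
      if "finite S" "S \<subseteq> carrier M \<times> UNIV" for S c
      using that
    proof (induction S)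
      case empty
      have "?W +>\<^bsub>?F\<^esub> 0 = j ((0 * 1) \<odot>\<^bsub>M\<^esub> \<zero>\<^bsub>M\<^esub>)"
        using single[of "\<zero>\<^bsub>M\<^esub>" 1 0] by simp
      then show ?case
        using M.smult_in_carrier[OF M.M.zero_closed] by (metis sum.empty)
    next
      case (insert k S)
      obtain x z where k: "k = (x, z)" and x: "x \<in> carrier M"
        using insert.prems by auto
      obtain y where y: "y \<in> carrier M"
        and S: "?W +>\<^bsub>?F\<^esub> (\<Sum>k\<in>S. Poly_Mapping.single k (c k)) = j y"
        using insert by auto
      have "Poly_Mapping.keys (\<Sum>k\<in>S. Poly_Mapping.single k (c k)) \<subseteq> S"
        using insert.hyps(1) by (auto simp: in_keys_iff lookup_sum lookup_single when_def split: if_splits)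
      then have "(\<Sum>k\<in>S. Poly_Mapping.single k (c k)) \<in> carrier ?F"
        using insert.prems by auto
      moreover have "Poly_Mapping.single k (c k) \<in> carrier ?F"
        using x k by simp
      ultimately have "?W +>\<^bsub>?F\<^esub> (\<Sum>k\<in>insert k S. Poly_Mapping.single k (c k)) = j ((c k * z) \<odot>\<^bsub>M\<^esub> x \<oplus>\<^bsub>M\<^esub> y)"
        using insert.hyps x y W.add_quotient[of "Poly_Mapping.single k (c k)" "\<Sum>k\<in>S. Poly_Mapping.single k (c k)"]
        by (simp add: j_add single[OF x] k S tensor_gmodule_eq)
      then show ?case
        using x y M.M.a_closed M.smult_in_carrier by metis
    qed
    note sums = this
    have "\<exists>x\<in>carrier M. ?W +>\<^bsub>?F\<^esub> u = j x" if "u \<in> carrier ?F" for u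
    proof -
      have "Poly_Mapping.keys u \<subseteq> carrier M \<times> UNIV"
        using that by simp
      from sums[OF finite_keys this, of "Poly_Mapping.lookup u"] show ?thesis
        unfolding sum_single_lookup[OF finite_keys subset_refl] .
    qed
    then show "carrier (tensor_gmodule M sgn_gmodule) \<subseteq> j ` carrier M"
      unfolding tensor_gmodule_eq W.carrier_quotient by blast
  qed (use j_closed in auto)
  ultimately have "cg_isomorphism G (twist_gmodule (\<lambda>g. of_int (sign g)) M) (tensor_gmodule M sgn_gmodule) j"
    using j_add j_smult j_act by (simp add: cg_isomorphism_def bij_betw_def)
  then show ?thesis
    by blast
qed

section \<open>Homology as a module over the group algebra\<close>

lemma group_symmetric_group: "group (symmetric_group V)"
proof (rule groupI)
  fix p assume "p \<in> carrier (symmetric_group V)"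
  then show "\<exists>q\<in>carrier (symmetric_group V). q \<otimes>\<^bsub>symmetric_group V\<^esub> p = \<one>\<^bsub>symmetric_group V\<^esub>"
    using permutes_inv[of p V] permutes_inv_o(2)[of p V] by (auto simp: symmetric_group_def)
qed (auto simp: symmetric_group_def permutes_compose permutes_id comp_assoc)

lemma chain_gmodule_simps [simp]:
  "carrier (chain_gmodule C) = C" "\<zero>\<^bsub>chain_gmodule C\<^esub> = (\<lambda>xs. 0)"
  "c \<oplus>\<^bsub>chain_gmodule C\<^esub> d = (\<lambda>xs. c xs + d xs)" "a \<odot>\<^bsub>chain_gmodule C\<^esub> c = (\<lambda>xs. a * c xs)"
  "act (chain_gmodule C) g c = chain_act g c"
  by (simp_all add: chain_gmodule_def)

lemma abelian_group_chain_gmodule: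
  assumes "chain_subspace C"
  shows "abelian_group (chain_gmodule C)"
proof (rule abelian_groupI)
  fix c assume "c \<in> carrier (chain_gmodule C)"
  then show "\<exists>d\<in>carrier (chain_gmodule C). d \<oplus>\<^bsub>chain_gmodule C\<^esub> c = \<zero>\<^bsub>chain_gmodule C\<^esub>"
    using chain_subspace_rules[OF assms] by (intro bexI[of _ "\<lambda>xs. - c xs"]) auto
qed (use chain_subspace_rules[OF assms] in \<open>auto simp: add.assoc add.commute\<close>)

lemma a_inv_chain_gmodule:
  assumes "chain_subspace C" "c \<in> C"
  shows "\<ominus>\<^bsub>chain_gmodule C\<^esub> c = (\<lambda>xs. - c xs)"
  using assms chain_subspace_rules(5)[OF assms(1)]
  by (intro abelian_group.minus_equality[OF abelian_group_chain_gmodule]) auto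

lemma cg_module_chain_gmodule:
  assumes G: "subgroup G (symmetric_group V)" and C: "chain_subspace C"
    and stable: "\<And>g c. g \<in> G \<Longrightarrow> c \<in> C \<Longrightarrow> chain_act g c \<in> C"
  shows "cg_module ((symmetric_group V)\<lparr>carrier := G\<rparr>) (chain_gmodule C)"
proof (intro cg_module.intro moduleI cg_module_axioms.intro)
  show "group ((symmetric_group V)\<lparr>carrier := G\<rparr>)"
    by (rule subgroup.subgroup_is_group[OF G group_symmetric_group])
  fix g h c
  assume "g \<in> carrier ((symmetric_group V)\<lparr>carrier := G\<rparr>)" "h \<in> carrier ((symmetric_group V)\<lparr>carrier := G\<rparr>)"
  then have "g permutes V" "h permutes V"
    using subgroup.subset[OF G] by (auto simp: symmetric_group_def)
  then have "inv_into UNIV (g \<circ> h) = inv_into UNIV h \<circ> inv_into UNIV g"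
    by (simp add: o_inv_distrib permutes_bij)
  then show "act (chain_gmodule C) (g \<otimes>\<^bsub>(symmetric_group V)\<lparr>carrier := G\<rparr>\<^esub> h) c
      = act (chain_gmodule C) g (act (chain_gmodule C) h c)"
    by (simp add: symmetric_group_def chain_act_def)
qed (use chain_subspace_rules[OF C] stable in \<open>auto simp: cring_complex_ring
    abelian_group_chain_gmodule[OF C] chain_act_def symmetric_group_def algebra_simps\<close>)

lemma cg_submodule_chain_gmodule:
  assumes G: "subgroup G (symmetric_group V)" and C: "chain_subspace C" and N: "chain_subspace N"
    and NC: "N \<subseteq> C"
    and stable: "\<And>g c. g \<in> G \<Longrightarrow> c \<in> C \<Longrightarrow> chain_act g c \<in> C"
    and stable': "\<And>g c. g \<in> G \<Longrightarrow> c \<in> N \<Longrightarrow> chain_act g c \<in> N"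
  shows "cg_submodule ((symmetric_group V)\<lparr>carrier := G\<rparr>) (chain_gmodule C) N"
proof -
  interpret cg_module "(symmetric_group V)\<lparr>carrier := G\<rparr>" "chain_gmodule C"
    by (rule cg_module_chain_gmodule[OF G C stable])
  show ?thesis
  proof (intro cg_submodule.intro cg_submodule_axioms.intro cg_module_axioms M.submoduleI)
    show "\<ominus>\<^bsub>chain_gmodule C\<^esub> c \<in> N" if "c \<in> N" for c
      using that NC a_inv_chain_gmodule[OF C] chain_subspace_rules(5)[OF N] by auto
  qed (use NC chain_subspace_rules[OF N] stable' in auto)
qed

lemma chain_act_zero [simp]: "chain_act g (\<lambda>xs. 0) = (\<lambda>xs. 0)"
  by (simp add: chain_act_def)

lemma cg_submodule_homology:
  assumes G: "subgroup G (symmetric_group V)" and K: "simplicial_complex V K"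
    and sym: "\<And>g. g \<in> G \<Longrightarrow> preserves g K"
  shows "cg_submodule ((symmetric_group V)\<lparr>carrier := G\<rparr>)
    (chain_gmodule {c \<in> oriented_chains K i. boundary V c = (\<lambda>xs. 0)})
    (boundary V ` oriented_chains K (i + 1))"
proof (rule cg_submodule_chain_gmodule[OF G])
  have perm: "g permutes V" if "g \<in> G" for g
    using that subgroup.subset[OF G] by (auto simp: symmetric_group_def)
  show "boundary V ` oriented_chains K (i + 1) \<subseteq> {c \<in> oriented_chains K i. boundary V c = (\<lambda>xs. 0)}"
    using K alternating_chain_boundary[of K] has_degree_boundary[of "i + 1"] boundary_boundary
    by (fastforce simp: oriented_chains_iff simplicial_complex_def alternating_chain_def)
  show "chain_act g c \<in> {c \<in> oriented_chains K i. boundary V c = (\<lambda>xs. 0)}"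
    if "g \<in> G" "c \<in> {c \<in> oriented_chains K i. boundary V c = (\<lambda>xs. 0)}" for g c
    using that perm by (simp add: chain_act_oriented_chains sym chain_act_boundary)
  show "chain_act g c \<in> boundary V ` oriented_chains K (i + 1)"
    if "g \<in> G" "c \<in> boundary V ` oriented_chains K (i + 1)" for g c
    using that perm chain_act_oriented_chains[OF sym]
    by (auto simp flip: chain_act_boundary)
qed (intro chain_subspace_kernel chain_subspace_image chain_subspace_oriented_chains
    linear_operator_boundary)+

lemma cg_submodule_cohomology:
  assumes G: "subgroup G (symmetric_group V)" and L: "simplicial_complex V L"
    and sym: "\<And>g. g \<in> G \<Longrightarrow> preserves g L"
  shows "cg_submodule ((symmetric_group V)\<lparr>carrier := G\<rparr>)
    (chain_gmodule {c \<in> oriented_chains L i. coboundary L c = (\<lambda>xs. 0)})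
    (coboundary L ` oriented_chains L (i - 1))"
proof (rule cg_submodule_chain_gmodule[OF G])
  show "coboundary L ` oriented_chains L (i - 1)
      \<subseteq> {c \<in> oriented_chains L i. coboundary L c = (\<lambda>xs. 0)}"
    using L alternating_chain_coboundary[of _ L] has_degree_coboundary[of "i - 1" _ L]
      coboundary_coboundary[of L]
    by (fastforce simp: oriented_chains_iff simplicial_complex_def alternating_chain_def)
  show "chain_act g c \<in> {c \<in> oriented_chains L i. coboundary L c = (\<lambda>xs. 0)}"
    if "g \<in> G" "c \<in> {c \<in> oriented_chains L i. coboundary L c = (\<lambda>xs. 0)}" for g c
    using that by (simp add: chain_act_oriented_chains sym chain_act_coboundary)
  show "chain_act g c \<in> coboundary L ` oriented_chains L (i - 1)"
    if "g \<in> G" "c \<in> coboundary L ` oriented_chains L (i - 1)" for g c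
    using that chain_act_oriented_chains[OF sym] by (auto simp: sym simp flip: chain_act_coboundary)
qed (intro chain_subspace_kernel chain_subspace_image chain_subspace_oriented_chains
    linear_operator_coboundary)+

section \<open>Alexander duality\<close>

lemma ex_orientation:
  assumes "finite V"
  shows "\<exists>\<omega>. oriented_vertex_set V \<omega>"
proof -
  obtain vs where vs: "distinct vs" "set vs = V"
    using finite_distinct_list[OF assms] by blast
  have "oriented_simplex vs zs * oriented_simplex vs zs = 1" if "distinct zs" "set zs = V" for zs
  proof -
    have "mset zs = mset vs"
      using set_eq_iff_mset_eq_distinct[of zs vs] vs that by simp
    then obtain p where p: "p permutes {..<length vs}" "permute_list p vs = zs"
      using mset_eq_permutation by blast
    have "oriented_simplex vs zs = of_int (sign p)"
      using oriented_simplex_permute[OF vs(1) p(1)] p(2) by simp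
    then show ?thesis
      by (metis of_int_1 of_int_mult sign_idempotent)
  qed
  moreover have "alternating (oriented_simplex vs)"
    using oriented_simplex_in_chains[OF vs(1), of "Pow V"] vs(2)
    by (simp add: oriented_chains_iff alternating_chain_def)
  ultimately show ?thesis
    using assms unfolding oriented_vertex_set_def by blast
qed

theorem theorem2:
  fixes V :: "'a set" and K :: "'a set set" and G :: "('a \<Rightarrow> 'a) set" and n :: nat and i :: int
  assumes "finite V" and "V \<noteq> {}" and "card V = n"
    and "simplicial_complex V K"
    and "subgroup G (symmetric_group V)"
    and "\<forall>g\<in>G. \<forall>\<sigma>\<in>K. g ` \<sigma> \<in> K"
  shows "cg_isomorphic ((symmetric_group V)\<lparr>carrier := G\<rparr>)
    (reduced_homology V K i)
    (tensor_gmodule (reduced_cohomology (alexander_dual V K) (int n - i - 3)) sgn_gmodule)"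
proof -
  let ?G = "(symmetric_group V)\<lparr>carrier := G\<rparr>" and ?L = "alexander_dual V K"
  obtain \<omega> where "oriented_vertex_set V \<omega>"
    using ex_orientation[OF assms(1)] by blast
  then interpret alexander_duality V \<omega> K
    using assms(2,4) by (simp add: alexander_duality_def alexander_duality_axioms_def)
  have perm: "g permutes V" if "g \<in> G" for g
    using that subgroup.subset[OF assms(5)] by (auto simp: symmetric_group_def)
  have sym: "preserves g K" if g: "g \<in> G" for g
  proof -
    have g_perm: "g permutes V"
      using g by (rule perm)
    have inv: "inv\<^bsub>symmetric_group V\<^esub> g = inv_into UNIV g"
      using permutes_inv[OF g_perm] permutes_inv_o(2)[OF g_perm] g_perm
      by (intro group.inv_equality[OF group_symmetric_group]) (auto simp: symmetric_group_def)
    have "inv_into UNIV g \<in> G"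
      using subgroup.m_inv_closed[OF assms(5) g] inv by simp
    then have "inv_into UNIV g ` g ` \<sigma> \<in> K" if "g ` \<sigma> \<in> K" for \<sigma>
      using assms(6) that by blast
    then show ?thesis
      using assms(6) g permutes_bij[OF g_perm]
      unfolding preserves_def by (metis bij_is_inj image_inv_f_f)
  qed
  have L: "simplicial_complex V ?L"
    using dual_subset dual_closed by (simp add: simplicial_complex_def)
  have sym_L: "preserves g ?L" if "g \<in> G" for g
    using that perm sym by (intro preserves_alexander_dual) auto
  let ?Z = "{c \<in> oriented_chains K i. boundary V c = (\<lambda>xs. 0)}"
    and ?B = "boundary V ` oriented_chains K (i + 1)"
    and ?j = "int n - i - 3"
  let ?Z' = "{c \<in> oriented_chains ?L ?j. coboundary ?L c = (\<lambda>xs. 0)}"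
    and ?B' = "coboundary ?L ` oriented_chains ?L (?j - 1)"
  note H = cg_submodule_homology[OF assms(5,4) sym, of i]
  note H' = cg_submodule_cohomology[OF assms(5) L sym_L, of ?j]
  have j: "?j = int (card V) - i - 3" "?j - 1 = int (card V) - i - 4"
    using assms(3) by auto
  have Z: "duality_map c \<in> ?Z'" if "c \<in> ?Z" for c
    using that duality_map_in_chains coboundary_duality_map by (auto simp: oriented_chains_iff j)
  have twisted: "\<exists>f. cg_isomorphism ?G (reduced_homology V K i)
      (twist_gmodule (\<lambda>g. of_int (sign g)) (reduced_cohomology ?L ?j)) f"
    unfolding reduced_homology_def reduced_cohomology_def
  proof (rule quotient_isomorphism[OF H H', where F = duality_map])
    fix c assume c: "c \<in> carrier (chain_gmodule ?Z)"
    then show "duality_map c \<in> carrier (chain_gmodule ?Z')"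
      using Z by simp
    show "duality_map c \<in> ?B' \<longleftrightarrow> c \<in> ?B"
      using c duality_map_coboundary_iff[of c i] by (simp add: j)
    fix g assume "g \<in> carrier ?G"
    then show "duality_map (act (chain_gmodule ?Z) g c)
        = of_int (sign g) \<odot>\<^bsub>chain_gmodule ?Z'\<^esub> act (chain_gmodule ?Z') g (duality_map c)"
      using c perm sym duality_map_chain_act
      by (simp add: oriented_chains_iff alternating_chain_def)
  next
    fix \<phi> assume \<phi>: "\<phi> \<in> carrier (chain_gmodule ?Z')"
    then obtain c where c: "c \<in> ?Z" and diff: "(\<lambda>ys. \<phi> ys - duality_map c ys) \<in> ?B'"
      using duality_map_onto[of \<phi> i] by (auto simp: j)
    have "chain_subspace ?Z'"
      by (intro chain_subspace_kernel chain_subspace_oriented_chains linear_operator_coboundary)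
    then have "\<ominus>\<^bsub>chain_gmodule ?Z'\<^esub> duality_map c = (\<lambda>ys. - duality_map c ys)"
      using Z[OF c] by (rule a_inv_chain_gmodule)
    then show "\<exists>c\<in>carrier (chain_gmodule ?Z).
        \<phi> \<oplus>\<^bsub>chain_gmodule ?Z'\<^esub> \<ominus>\<^bsub>chain_gmodule ?Z'\<^esub> duality_map c \<in> ?B'"
      using c diff by (intro bexI[of _ c]) simp_all
  qed (simp_all add: linear_operator_rules[OF linear_operator_duality_map])
  have mod_H: "cg_module ?G (reduced_homology V K i)"
    unfolding reduced_homology_def by (rule cg_submodule.cg_module_quotient[OF H])
  have mod_H': "cg_module ?G (reduced_cohomology ?L ?j)"
    unfolding reduced_cohomology_def by (rule cg_submodule.cg_module_quotient[OF H'])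
  have mod_sgn: "cg_module ?G sgn_gmodule"
    by (rule cg_module_sgn[OF assms(5) group_symmetric_group assms(1)])
  have "\<exists>f. cg_isomorphism ?G (reduced_homology V K i)
      (tensor_gmodule (reduced_cohomology ?L ?j) sgn_gmodule) f"
    using twisted tensor_sgn_isomorphism[OF mod_H' mod_sgn] cg_isomorphism_comp by blast
  then show ?thesis
    unfolding cg_isomorphic_def using mod_H cg_module_tensor[OF mod_H' mod_sgn] by blast
qed

end
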